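(* Let $\tilde Q_F$ be the unique strong solution to $$\tilde Q_F(t)=\tilde M_Q(t)+\tilde Q_I(t)-\beta F_e(t)+\int_0^t\tilde Q_F^+(t-s)\,dF(s),\qquad t\ge0,$$ with the ingredients described in the context (this is the diffusion limit of the scaled queue length process of the $G/GI/N$ queue in the Halfin–Whitt regime), and let $\tilde\zeta=\tilde M_Q+\tilde Q_I$. Then $\tilde Q_F$ may be equivalently expressed as the unique strong solution to $$\tilde Q_M(t)=\tilde\zeta(t)+\int_0^t\tilde\zeta(t-u)\,dM(u)-\beta t-\int_0^t\tilde Q_M^-(t-u)\,dM(u),\qquad t\ge0,$$ where $\tilde Q_M^-(t)=\min(\tilde Q_M(t),0)$ and $M$ is the renewal function associated with the pure renewal process with interarrival distribution $F$.
   Context: $F$ is the distribution function of a nonnegative random variable with mean $1$, with $F=0$ on $(-\infty,0)$; $G=1-F$; $F_e(x)=\int_0^xG(u)\,du$ for $x\ge 0$; $\bar F_e=1-F_e$; $\beta\in\mathbb R$; $x^+=\max(x,0)$. Integrals $\int_0^t$ against $dF$ and $dM$ are over the closed interval $[0,t]$ (mass at $0$ included). The renewal function $M=\{M(t),t\ge0\}$ (expected number of renewals by time $t$, not counting a renewal at the origin by default) is the unique solution to $M(t)=F(t)+\int_0^tM(t-u)\,dF(u)$, $t\ge0$. $D[0,\infty)$ is the space of right-continuous real functions on $[0,\infty)$ with left limits. "Strong solution" means pathwise solution with paths in $D[0,\infty)$. The following are mutually independent: a real random variable $\tilde Q_0$; $\tilde W_0(F_e)=\{\tilde W_0(F_e(t)),t\ge0\}$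 with $\tilde W_0$ a Brownian bridge on $[0,1]$; a process $\tilde\xi$ with a.s. continuous paths; and a centered Gaussian process $\tilde M_2$ with paths in $D[0,\infty)$ and $E[\tilde M_2(t)\tilde M_2(t+\delta)]=\int_0^tG(t+\delta-u)F(t-u)\,du$ for $t,\delta\ge0$. Put $\tilde H=\tilde Q_0\bar F_e$, $\tilde M_Q=\tilde Q_0^+(G-\bar F_e)$, $\tilde M_1(t)=\int_0^tG(t-s)\,d\tilde\xi(s)$, interpreted through integration by parts as $\tilde M_1(t)=\tilde\xi(t)-\int_0^t\tilde\xi(t-s)\,dF(s)$, and $\tilde Q_I=\tilde H+\tilde W_0(F_e)+\tilde M_1+\tilde M_2$. *)

theory Defs
  imports "HOL-Probability.Probability"
begin

definition cadlag :: "(real \<Rightarrow> real) \<Rightarrow> bool" where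
  "cadlag f \<longleftrightarrow>
     (\<forall>t\<ge>0. (f \<longlongrightarrow> f t) (at_right t)) \<and> (\<forall>t>0. \<exists>l. (f \<longlongrightarrow> l) (at_left t))"

text \<open>
  The Stieltjes convolution \<open>\<integral>\<^sub>[\<^sub>0\<^sub>,\<^sub>t\<^sub>] f (t - u) dA(u)\<close>. It is used only for nondecreasing
  right-continuous \<open>A\<close> vanishing on the negative half-line, so that the atom of
  \<open>interval_measure A\<close> at \<open>0\<close>, which is included in the range of integration, is \<open>A 0\<close>.
\<close>
definition stieltjes_conv :: "(real \<Rightarrow> real) \<Rightarrow> (real \<Rightarrow> real) \<Rightarrow> real \<Rightarrow> real" where
  "stieltjes_conv f A t = (LINT u:{0..t}|interval_measure A. f (t - u))"

text \<open>
  Uniqueness for the renewal equation is meant among locally bounded Borel functions,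
  extended by \<open>0\<close> to the negative half-line.
\<close>
definition solves_renewal_equation :: "(real \<Rightarrow> real) \<Rightarrow> (real \<Rightarrow> real) \<Rightarrow> bool" where
  "solves_renewal_equation F M \<longleftrightarrow>
     M \<in> borel_measurable borel \<and>
     (\<forall>t<0. M t = 0) \<and>
     (\<forall>T\<ge>0. bounded (M ` {0..T})) \<and>
     (\<forall>t\<ge>0. M t = F t + stieltjes_conv M F t)"

definition renewal_function :: "(real \<Rightarrow> real) \<Rightarrow> real \<Rightarrow> real" where
  "renewal_function F = (THE M. solves_renewal_equation F M)"

text \<open>Normal random variables; the degenerate (almost surely constant) case is included.\<close>
definition gaussian_rv :: "'w measure \<Rightarrow> ('w \<Rightarrow> real) \<Rightarrow> bool" where
  "gaussian_rv P Z \<longleftrightarrow>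
     Z \<in> borel_measurable P \<and>
     ((\<exists>c. AE \<omega> in P. Z \<omega> = c) \<or>
      (\<exists>m \<sigma>. \<sigma> > 0 \<and> distributed P lborel Z (\<lambda>x. ennreal (normal_density m \<sigma> x))))"

definition centered_gaussian_process ::
    "'w measure \<Rightarrow> real set \<Rightarrow> (real \<Rightarrow> 'w \<Rightarrow> real) \<Rightarrow> bool" where
  "centered_gaussian_process P T X \<longleftrightarrow>
     (\<forall>J a. finite J \<and> J \<subseteq> T \<longrightarrow> gaussian_rv P (\<lambda>\<omega>. \<Sum>t\<in>J. a t * X t \<omega>)) \<and>
     (\<forall>t\<in>T. (LINT \<omega>|P. X t \<omega>) = 0)"

definition brownian_bridge :: "'w measure \<Rightarrow> (real \<Rightarrow> 'w \<Rightarrow> real) \<Rightarrow> bool" where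
  "brownian_bridge P W \<longleftrightarrow>
     centered_gaussian_process P {0..1} W \<and>
     (\<forall>s\<in>{0..1}. \<forall>t\<in>{0..1}. (LINT \<omega>|P. W s \<omega> * W t \<omega>) = min s t - s * t) \<and>
     (AE \<omega> in P. continuous_on {0..1} (\<lambda>t. W t \<omega>))"

text \<open>
  Mutual independence of processes indexed by \<open>T\<close>, as random elements of the path space with its
  product \<open>\<sigma>\<close>-algebra. A single random variable is passed as a process that is constant in time,
  which generates the same \<open>\<sigma>\<close>-algebra when \<open>T\<close> is nonempty.
\<close>
definition independent_processes ::
    "'w measure \<Rightarrow> real set \<Rightarrow> (real \<Rightarrow> 'w \<Rightarrow> real) list \<Rightarrow> bool" where
  "independent_processes P T Xs \<longleftrightarrow>
     prob_space.indep_vars P (\<lambda>_. PiM T (\<lambda>_. borel))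
       (\<lambda>i \<omega>. \<lambda>t\<in>T. (Xs ! i) t \<omega>) {..<length Xs}"

text \<open>
  Pathwise (strong) solutions of \<open>Q(t) = \<Phi>(\<omega>, Q, t)\<close>, \<open>t \<ge> 0\<close>, where \<open>\<Phi>\<close> receives the sample point
  and the whole path of \<open>Q\<close>. The equation holds for all \<open>t\<close> simultaneously outside a null set, and
  uniqueness is up to indistinguishability, since some of the driving processes are regular only
  almost surely.
\<close>
definition strong_solution ::
    "'w measure \<Rightarrow> ('w \<Rightarrow> (real \<Rightarrow> real) \<Rightarrow> real \<Rightarrow> real) \<Rightarrow> (real \<Rightarrow> 'w \<Rightarrow> real) \<Rightarrow> bool" where
  "strong_solution P \<Phi> Q \<longleftrightarrow>
     (\<forall>t\<ge>0. Q t \<in> borel_measurable P) \<and>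
     (\<forall>\<omega>\<in>space P. cadlag (\<lambda>t. Q t \<omega>)) \<and>
     (AE \<omega> in P. \<forall>t\<ge>0. Q t \<omega> = \<Phi> \<omega> (\<lambda>s. Q s \<omega>) t)"

definition unique_strong_solution ::
    "'w measure \<Rightarrow> ('w \<Rightarrow> (real \<Rightarrow> real) \<Rightarrow> real \<Rightarrow> real) \<Rightarrow> (real \<Rightarrow> 'w \<Rightarrow> real) \<Rightarrow> bool" where
  "unique_strong_solution P \<Phi> Q \<longleftrightarrow>
     strong_solution P \<Phi> Q \<and>
     (\<forall>Q'. strong_solution P \<Phi> Q' \<longrightarrow> (AE \<omega> in P. \<forall>t\<ge>0. Q' t \<omega> = Q t \<omega>))"

end

theory Submission
  imports Defs
begin

text \<open>
  Write \<open>C f\<close> and \<open>D f\<close> for the convolutions of a path \<open>f\<close> with \<open>dF\<close> and with \<open>dM\<close>. The renewal measure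
  satisfies \<open>dM = dF + dM * dF\<close>, so that \<open>D = C + C D\<close>, which says that \<open>1 + D\<close> inverts \<open>1 - C\<close>. Since
  \<open>q\<^sup>+ = q - q\<^sup>-\<close> with \<open>q\<^sup>- = min q 0\<close>, the first equation is \<open>(1 - C) q = \<zeta> - \<beta> F\<^sub>e - C q\<^sup>-\<close>. Moreover
  \<open>F\<^sub>e = (1 - C) id\<close>, because \<open>C id\<close> is the integral of \<open>F\<close>. Applying \<open>1 + D\<close> therefore turns the first
  equation into \<open>q = (1 + D) \<zeta> - \<beta> id - D q\<^sup>-\<close>, the second one.

  The comparison is made path by path and rests on the injectivity of \<open>1 - C\<close>: if \<open>r\<close> is the
  right-hand side of the second equation, then \<open>D = C + C D\<close> gives
  \<open>r - C r = \<zeta> - \<beta> F\<^sub>e - C q\<^sup>-\<close>, so the first equation holds iff \<open>(1 - C) (q - r) = 0\<close>. This is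
  \<open>renewal_resolvent_equivalence\<close>.

  Injectivity, uniqueness and existence all come from one estimate. In the weighted norm
  \<open>sup e\<^sup>-\<^sup>t \<bar>f t\<bar>\<close> over \<open>[0, T]\<close> the operator \<open>C\<close> is bounded by the Laplace transform of \<open>F\<close> at \<open>1\<close>, and this
  is less than \<open>1\<close> because interarrival times do not vanish almost surely
  (\<open>stieltjes_conv_geometric_decay\<close>). The map \<open>q \<mapsto> q\<^sup>+\<close> does not increase distances, so the first
  equation is a fixed point problem for a contraction. Its Picard iterates are measurable in the sample
  point and cadlag in time, and converge locally uniformly (\<open>picard_limit\<close>, \<open>strong_solution_exists\<close>).
  Convolution with \<open>dM\<close> is in general not a contraction in any such norm, as \<open>dM\<close> can have an atom of mass
  larger than \<open>1\<close> at the origin; uniqueness for the second equation is inherited through the equivalence.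

  The function \<open>M\<close> is only given as the solution of the renewal equation. It is identified in
  \<open>renewal_function_cdf\<close> as the distribution function of the expected counting measure of the partial
  sums of independent interarrival times. Conditioning on the first interarrival time yields
  \<open>dM = dF + dM * dF\<close>, and the Laplace transform of this measure is a convergent geometric series,
  which gives local finiteness.
\<close>

section \<open>Cadlag and locally bounded Borel paths\<close>

text \<open>
  Paths are only meaningful on \<open>[0, \<infinity>)\<close>, while the type is the whole line. Cutting off the negative
  half-line makes a convolution over \<open>[0, t]\<close> an integral over the whole line.
\<close>
definition zero_ext :: "(real \<Rightarrow> real) \<Rightarrow> real \<Rightarrow> real" where
  "zero_ext f t = (if 0 \<le> t then f t else 0)"

definition locally_bounded_borel :: "(real \<Rightarrow> real) \<Rightarrow> bool" where
  "locally_bounded_borel f \<longleftrightarrow>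
     zero_ext f \<in> borel_measurable borel \<and> (\<forall>T. \<exists>B. \<forall>t\<in>{0..T}. \<bar>f t\<bar> \<le> B)"

lemma locally_bounded_borel_measurable:
  "locally_bounded_borel f \<Longrightarrow> zero_ext f \<in> borel_measurable borel"
  by (simp add: locally_bounded_borel_def)

lemma locally_bounded_borel_bound:
  assumes "locally_bounded_borel f"
  obtains B where "0 \<le> B" "\<And>t. t \<in> {0..T} \<Longrightarrow> \<bar>f t\<bar> \<le> B"
proof -
  obtain B where B: "\<forall>t\<in>{0..T}. \<bar>f t\<bar> \<le> B"
    using assms unfolding locally_bounded_borel_def by blast
  show ?thesis
    by (rule that[of "max B 0"]) (use B in force)+
qed

lemma locally_bounded_borel_const: "locally_bounded_borel (\<lambda>_. c)"
proof -
  have "zero_ext (\<lambda>_. c) = (\<lambda>t. indicator {0..} t * c)"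
    by (auto simp: zero_ext_def fun_eq_iff)
  then show ?thesis
    unfolding locally_bounded_borel_def by auto
qed

lemma locally_bounded_borel_add:
  assumes f: "locally_bounded_borel f" and g: "locally_bounded_borel g"
  shows "locally_bounded_borel (\<lambda>t. f t + g t)"
proof -
  have "zero_ext (\<lambda>t. f t + g t) = (\<lambda>t. zero_ext f t + zero_ext g t)"
    by (auto simp: zero_ext_def fun_eq_iff)
  moreover have "\<exists>B. \<forall>t\<in>{0..T}. \<bar>f t + g t\<bar> \<le> B" for T
  proof -
    obtain A B where "\<And>t. t \<in> {0..T} \<Longrightarrow> \<bar>f t\<bar> \<le> A" "\<And>t. t \<in> {0..T} \<Longrightarrow> \<bar>g t\<bar> \<le> B"
      using locally_bounded_borel_bound[OF f] locally_bounded_borel_bound[OF g] by metis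
    then have "\<forall>t\<in>{0..T}. \<bar>f t + g t\<bar> \<le> A + B"
      by (meson abs_triangle_ineq add_mono order_trans)
    then show ?thesis ..
  qed
  ultimately show ?thesis
    using f g by (auto simp: locally_bounded_borel_def)
qed

lemma locally_bounded_borel_mult:
  assumes f: "locally_bounded_borel f" and g: "locally_bounded_borel g"
  shows "locally_bounded_borel (\<lambda>t. f t * g t)"
proof -
  have "zero_ext (\<lambda>t. f t * g t) = (\<lambda>t. zero_ext f t * zero_ext g t)"
    by (auto simp: zero_ext_def fun_eq_iff)
  moreover have "\<exists>B. \<forall>t\<in>{0..T}. \<bar>f t * g t\<bar> \<le> B" for T
  proof -
    obtain A B where "0 \<le> A" "0 \<le> B"
      "\<And>t. t \<in> {0..T} \<Longrightarrow> \<bar>f t\<bar> \<le> A" "\<And>t. t \<in> {0..T} \<Longrightarrow> \<bar>g t\<bar> \<le> B"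
      using locally_bounded_borel_bound[OF f] locally_bounded_borel_bound[OF g] by metis
    then have "\<forall>t\<in>{0..T}. \<bar>f t * g t\<bar> \<le> A * B"
      by (auto simp: abs_mult intro!: mult_mono)
    then show ?thesis ..
  qed
  ultimately show ?thesis
    using f g by (auto simp: locally_bounded_borel_def)
qed

lemma locally_bounded_borel_cmult:
  "locally_bounded_borel f \<Longrightarrow> locally_bounded_borel (\<lambda>t. c * f t)"
  by (intro locally_bounded_borel_mult locally_bounded_borel_const)

lemma locally_bounded_borel_diff:
  assumes "locally_bounded_borel f" "locally_bounded_borel g"
  shows "locally_bounded_borel (\<lambda>t. f t - g t)"
  using locally_bounded_borel_add[OF assms(1) locally_bounded_borel_cmult[OF assms(2), of "-1"]]
  by simp

lemma locally_bounded_borel_max: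
  assumes f: "locally_bounded_borel f"
  shows "locally_bounded_borel (\<lambda>t. max (f t) 0)"
proof -
  have "zero_ext (\<lambda>t. max (f t) 0) = (\<lambda>t. max (zero_ext f t) 0)"
    by (auto simp: zero_ext_def fun_eq_iff)
  moreover have "\<exists>B. \<forall>t\<in>{0..T}. \<bar>max (f t) 0\<bar> \<le> B" for T
  proof -
    obtain B where "0 \<le> B" "\<And>t. t \<in> {0..T} \<Longrightarrow> \<bar>f t\<bar> \<le> B"
      using locally_bounded_borel_bound[OF f] by metis
    then have "\<forall>t\<in>{0..T}. \<bar>max (f t) 0\<bar> \<le> B"
      by fastforce
    then show ?thesis ..
  qed
  ultimately show ?thesis
    using f by (auto simp: locally_bounded_borel_def)
qed

lemma locally_bounded_borel_min:
  assumes "locally_bounded_borel f"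
  shows "locally_bounded_borel (\<lambda>t. min (f t) 0)"
proof -
  have "(\<lambda>t. min (f t) 0) = (\<lambda>t. -1 * max (-1 * f t) 0)"
    by (auto simp: fun_eq_iff max_def min_def)
  then show ?thesis
    using assms by (metis locally_bounded_borel_cmult locally_bounded_borel_max)
qed

lemma locally_bounded_borel_cong:
  assumes "locally_bounded_borel f" "\<And>t. 0 \<le> t \<Longrightarrow> f t = g t"
  shows "locally_bounded_borel g"
proof -
  have "zero_ext g = zero_ext f"
    using assms(2) by (auto simp: zero_ext_def fun_eq_iff)
  with assms show ?thesis
    unfolding locally_bounded_borel_def by (metis atLeastAtMost_iff)
qed


lemma cadlag_at_right: "cadlag f \<Longrightarrow> 0 \<le> t \<Longrightarrow> (f \<longlongrightarrow> f t) (at_right t)"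
  by (simp add: cadlag_def)

lemma cadlag_at_left:
  assumes "cadlag f" "0 < t"
  obtains l where "(f \<longlongrightarrow> l) (at_left t)"
  using assms by (auto simp: cadlag_def)

lemma cadlagI:
  assumes "\<And>t. 0 \<le> t \<Longrightarrow> (f \<longlongrightarrow> f t) (at_right t)"
    and "\<And>t. 0 < t \<Longrightarrow> \<exists>l. (f \<longlongrightarrow> l) (at_left t)"
  shows "cadlag f"
  using assms by (simp add: cadlag_def)

lemma cadlag_compose2:
  assumes h: "\<And>(K :: real filter) u v x y.
      (u \<longlongrightarrow> x) K \<Longrightarrow> (v \<longlongrightarrow> y) K \<Longrightarrow> ((\<lambda>t. h (u t) (v t)) \<longlongrightarrow> h x y) K"
    and f: "cadlag f" and g: "cadlag g"
  shows "cadlag (\<lambda>t. h (f t) (g t))"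
proof (rule cadlagI)
  fix t :: real assume "0 < t"
  with f g obtain l k where "(f \<longlongrightarrow> l) (at_left t)" "(g \<longlongrightarrow> k) (at_left t)"
    by (metis cadlag_at_left)
  then show "\<exists>l. ((\<lambda>t. h (f t) (g t)) \<longlongrightarrow> l) (at_left t)"
    using h by blast
qed (intro h cadlag_at_right f g)

lemma cadlag_const: "cadlag (\<lambda>_. c)"
  unfolding cadlag_def by auto

lemma cadlag_add: "cadlag f \<Longrightarrow> cadlag g \<Longrightarrow> cadlag (\<lambda>t. f t + g t)"
  by (rule cadlag_compose2[OF tendsto_add])

lemma cadlag_diff: "cadlag f \<Longrightarrow> cadlag g \<Longrightarrow> cadlag (\<lambda>t. f t - g t)"
  by (rule cadlag_compose2[OF tendsto_diff])

lemma cadlag_mult: "cadlag f \<Longrightarrow> cadlag g \<Longrightarrow> cadlag (\<lambda>t. f t * g t)"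
  by (rule cadlag_compose2[OF tendsto_mult])

lemma cadlag_max: "cadlag f \<Longrightarrow> cadlag (\<lambda>t. max (f t) 0)"
  by (rule cadlag_compose2[OF tendsto_max _ cadlag_const])

lemma cadlag_cong:
  assumes f: "cadlag f" and eq: "\<And>t. 0 \<le> t \<Longrightarrow> f t = g t"
  shows "cadlag g"
proof (rule cadlagI)
  fix t :: real assume t: "0 \<le> t"
  have "eventually (\<lambda>s. f s = g s) (at_right t)"
    using t eq by (auto simp: eventually_at_filter)
  then show "(g \<longlongrightarrow> g t) (at_right t)"
    using cadlag_at_right[OF f t] eq[OF t] by (metis tendsto_cong)
next
  fix t :: real assume t: "0 < t"
  then have "eventually (\<lambda>s. s > 0) (at_left t)"
    by (rule eventually_at_leftI[rotated]) auto
  then have "eventually (\<lambda>s. f s = g s) (at_left t)"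
    by eventually_elim (simp add: eq)
  then show "\<exists>l. (g \<longlongrightarrow> l) (at_left t)"
    using cadlag_at_left[OF f t] by (metis tendsto_cong)
qed

text \<open>
  A closed \<open>S\<close> also contains the left limits of \<open>f\<close>, so continuity of \<open>g\<close> on \<open>S\<close> alone suffices. It is
  applied to a Brownian bridge, which is continuous on \<open>[0, 1]\<close> only.
\<close>
lemma cadlag_compose_continuous:
  assumes g: "continuous_on S g" and S: "closed S" and f: "cadlag f"
    and mem: "\<And>t. 0 \<le> t \<Longrightarrow> f t \<in> S"
  shows "cadlag (\<lambda>t. g (f t))"
proof (rule cadlagI)
  fix t :: real assume t: "0 \<le> t"
  have "eventually (\<lambda>s. f s \<in> S) (at_right t)"
    using t mem by (auto simp: eventually_at_filter)
  then show "((\<lambda>t. g (f t)) \<longlongrightarrow> g (f t)) (at_right t)"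
    by (intro continuous_on_tendsto_compose[OF g cadlag_at_right[OF f t]] mem t)
next
  fix t :: real assume t: "0 < t"
  then have "eventually (\<lambda>s. s > 0) (at_left t)"
    by (rule eventually_at_leftI[rotated]) auto
  then have ev: "eventually (\<lambda>s. f s \<in> S) (at_left t)"
    by eventually_elim (simp add: mem)
  obtain l where l: "(f \<longlongrightarrow> l) (at_left t)"
    using cadlag_at_left[OF f t] .
  have "l \<in> S"
    by (rule Lim_in_closed_set[OF S ev _ l]) simp
  then show "\<exists>l. ((\<lambda>t. g (f t)) \<longlongrightarrow> l) (at_left t)"
    using continuous_on_tendsto_compose[OF g l _ ev] by blast
qed

lemma cadlag_continuous:
  assumes f: "continuous_on {0..} f"
  shows "cadlag f"
proof (rule cadlagI)
  fix t :: real assume "0 \<le> t"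
  then have "(f \<longlongrightarrow> f t) (at t within {0..})"
    using f by (simp add: continuous_on_def)
  then show "(f \<longlongrightarrow> f t) (at_right t)"
    by (rule tendsto_within_subset) (use \<open>0 \<le> t\<close> in auto)
next
  fix t :: real assume "0 < t"
  then have "at t within {0..} = at t"
    by (intro at_within_interior) (simp add: interior_Ici)
  moreover have "(f \<longlongrightarrow> f t) (at t within {0..})"
    using f \<open>0 < t\<close> by (simp add: continuous_on_def)
  ultimately show "\<exists>l. (f \<longlongrightarrow> l) (at_left t)"
    by (metis filterlim_at_split)
qed

text \<open>
  Right and left limits bound \<open>f\<close> near each point, and bisection of \<open>[0, T]\<close> makes this global.
\<close>
lemma cadlag_bounded:
  assumes f: "cadlag f"
  shows "\<exists>B. \<forall>t\<in>{0..T}. \<bar>f t\<bar> \<le> B"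
proof (cases "0 \<le> T")
  case True
  define P where "P a b \<longleftrightarrow> (0 \<le> a \<longrightarrow> (\<exists>B. \<forall>t\<in>{a..b}. \<bar>f t\<bar> \<le> B))" for a b
  have "P 0 T"
    using True
  proof (rule Bolzano)
    fix a b c assume P: "P a b" "P b c" and le: "a \<le> b" "b \<le> c"
    show "P a c"
      unfolding P_def
    proof
      assume a: "0 \<le> a"
      obtain A B where "\<forall>t\<in>{a..b}. \<bar>f t\<bar> \<le> A" "\<forall>t\<in>{b..c}. \<bar>f t\<bar> \<le> B"
        using P a le unfolding P_def by auto
      then have "\<forall>t\<in>{a..c}. \<bar>f t\<bar> \<le> max A B"
        by (metis atLeastAtMost_iff linorder_le_cases max.coboundedI1 max.coboundedI2)
      then show "\<exists>B. \<forall>t\<in>{a..c}. \<bar>f t\<bar> \<le> B" ..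
    qed
  next
    fix x assume x: "0 \<le> x" "x \<le> T"
    have "eventually (\<lambda>s. dist (f s) (f x) < 1) (at_right x)"
      using cadlag_at_right[OF f x(1)] by (rule tendstoD) simp
    then obtain r where r: "r > x" "\<And>s. x < s \<Longrightarrow> s < r \<Longrightarrow> dist (f s) (f x) < 1"
      unfolding eventually_at_right_field by blast
    obtain l q where q: "q < x" "\<And>s. q < s \<Longrightarrow> s < x \<Longrightarrow> 0 \<le> s \<Longrightarrow> dist (f s) l < 1"
    proof (cases "x = 0")
      case True
      then show ?thesis
        by (intro that[of "-1" 0]) auto
    next
      case False
      then obtain l where "(f \<longlongrightarrow> l) (at_left x)"
        using cadlag_at_left[OF f, of x] x by auto
      then have "eventually (\<lambda>s. dist (f s) l < 1) (at_left x)"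
        by (rule tendstoD) simp
      then show ?thesis
        unfolding eventually_at_left_field using that by blast
    qed
    define B where "B = \<bar>f x\<bar> + \<bar>l\<bar> + 1"
    have B: "\<bar>f s\<bar> \<le> B" if "q < s" "s < r" "0 \<le> s" for s
      using r(2)[of s] q(2)[of s] that unfolding B_def dist_real_def
      by (cases s x rule: linorder_cases) auto
    show "\<exists>d>0. \<forall>a b. a \<le> x \<and> x \<le> b \<and> b - a < d \<longrightarrow> P a b"
    proof (intro exI[of _ "min (r - x) (x - q)"] conjI allI impI)
      fix a b assume "a \<le> x \<and> x \<le> b \<and> b - a < min (r - x) (x - q)"
      then show "P a b"
        unfolding P_def by (intro impI exI[of _ B] ballI B) auto
    qed (use r q in auto)
  qed
  then show ?thesis
    by (simp add: P_def)
qed auto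

text \<open>
  A right-continuous process is the limit of its values at the next point of the grid of mesh
  \<open>1 / (n + 1)\<close>, and such a discretised process is measurable because it takes countably many time values.
\<close>
lemma borel_measurable_right_continuous_process:
  fixes X :: "real \<Rightarrow> 'a \<Rightarrow> real"
  assumes meas: "\<And>t. 0 \<le> t \<Longrightarrow> X t \<in> borel_measurable P"
    and cont: "\<And>t \<omega>. 0 \<le> t \<Longrightarrow> \<omega> \<in> space P \<Longrightarrow> ((\<lambda>s. X s \<omega>) \<longlongrightarrow> X t \<omega>) (at_right t)"
  shows "(\<lambda>(t, \<omega>). zero_ext (\<lambda>s. X s \<omega>) t) \<in> borel_measurable (borel \<Otimes>\<^sub>M P)"
proof -
  \<comment> \<open>The grid point lies strictly to the right of \<open>t\<close>, so that the limit along \<open>at_right t\<close> applies.\<close>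
  define grid where "grid n t = (of_int \<lfloor>real (Suc n) * t\<rfloor> + 1) / real (Suc n)" for n and t :: real
  have gt: "t < grid n t" and le: "grid n t \<le> t + 1 / real (Suc n)" for n t
    unfolding grid_def by (simp_all add: field_simps del: of_nat_Suc) linarith+
  define Y where "Y n = (\<lambda>(t, \<omega>). zero_ext (\<lambda>s. if 0 \<le> grid n s then X (grid n s) \<omega> else 0) t)" for n
  have Y: "Y n \<in> borel_measurable (borel \<Otimes>\<^sub>M P)" for n
  proof -
    define Z where "Z i = (\<lambda>z::real \<times> 'a. if 0 \<le> (of_int i + 1) / real (Suc n)
        then X ((of_int i + 1) / real (Suc n)) (snd z) else 0)" for i :: int
    have Z[measurable]: "Z i \<in> borel_measurable (borel \<Otimes>\<^sub>M P)" for i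
    proof (cases "0 \<le> (of_int i + 1 :: real) / real (Suc n)")
      case True
      then have [measurable]: "X ((of_int i + 1) / real (Suc n)) \<in> borel_measurable P"
        by (rule meas)
      show ?thesis
        unfolding Z_def using True by (simp del: of_nat_Suc)
    next
      case False
      then show ?thesis
        unfolding Z_def by (simp del: of_nat_Suc)
    qed
    have [measurable]: "(\<lambda>z. \<lfloor>real (Suc n) * fst z\<rfloor>) \<in> measurable (borel \<Otimes>\<^sub>M P) (count_space UNIV)"
      by measurable
    have "(\<lambda>z. Z \<lfloor>real (Suc n) * fst z\<rfloor> z) \<in> borel_measurable (borel \<Otimes>\<^sub>M P)"
      by (rule measurable_compose_countable[OF Z]) measurable
    then have "(\<lambda>z. if 0 \<le> fst z then Z \<lfloor>real (Suc n) * fst z\<rfloor> z else 0)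
        \<in> borel_measurable (borel \<Otimes>\<^sub>M P)"
      by measurable
    also have "(\<lambda>z. if 0 \<le> fst z then Z \<lfloor>real (Suc n) * fst z\<rfloor> z else 0) = Y n"
      by (auto simp: Y_def Z_def grid_def zero_ext_def fun_eq_iff)
    finally show ?thesis .
  qed
  show ?thesis
  proof (rule borel_measurable_LIMSEQ_real[OF _ Y])
    fix z :: "real \<times> 'a" assume "z \<in> space (borel \<Otimes>\<^sub>M P)"
    then obtain t \<omega> where z: "z = (t, \<omega>)" and \<omega>: "\<omega> \<in> space P"
      by (auto simp: space_pair_measure)
    show "(\<lambda>n. Y n z) \<longlonglongrightarrow> (case z of (t, \<omega>) \<Rightarrow> zero_ext (\<lambda>s. X s \<omega>) t)"
    proof (cases "0 \<le> t")
      case True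
      have "(\<lambda>n. t + 1 / real (Suc n)) \<longlonglongrightarrow> t + 0"
        by (intro tendsto_add tendsto_const LIMSEQ_Suc lim_1_over_n)
      then have "(\<lambda>n. grid n t) \<longlonglongrightarrow> t"
        by (intro tendsto_sandwich[of "\<lambda>_. t" "\<lambda>n. grid n t" _ "\<lambda>n. t + 1 / real (Suc n)"])
          (auto intro!: always_eventually less_imp_le gt le simp del: of_nat_Suc)
      then have "filterlim (\<lambda>n. grid n t) (at_right t) sequentially"
        using gt by (auto simp: filterlim_at intro!: always_eventually less_imp_neq[symmetric])
      then have "(\<lambda>n. X (grid n t) \<omega>) \<longlonglongrightarrow> X t \<omega>"
        by (rule filterlim_compose[OF cont[OF True \<omega>]])
      moreover have "0 \<le> grid n t" for n
        using gt[of t n] True by simp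
      ultimately show ?thesis
        using True by (simp add: z Y_def zero_ext_def)
    next
      case False
      then show ?thesis
        by (simp add: z Y_def zero_ext_def)
    qed
  qed
qed

text \<open>
  Measurability is that of a right-continuous process over a one-point sample space.
\<close>
lemma cadlag_locally_bounded_borel:
  assumes f: "cadlag f"
  shows "locally_bounded_borel f"
proof -
  have "(\<lambda>(t, \<omega>). zero_ext (\<lambda>s. f s) t) \<in> borel_measurable (borel \<Otimes>\<^sub>M count_space {()})"
    using cadlag_at_right[OF f] by (intro borel_measurable_right_continuous_process) auto
  from measurable_compose[OF measurable_Pair2'[of "()"] this]
  have "zero_ext f \<in> borel_measurable borel"
    by (simp add: eta_contract_eq)
  then show ?thesis
    using cadlag_bounded[OF f] by (simp add: locally_bounded_borel_def)
qed

lemma locally_bounded_borel_ident: "locally_bounded_borel (\<lambda>s. s)"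
  by (intro cadlag_locally_bounded_borel cadlag_continuous continuous_on_id)

text \<open>
  The left limits of the approximants form a Cauchy sequence, and limits may be exchanged.
\<close>
lemma cadlag_uniform_limit:
  assumes q: "\<And>n. cadlag (q n)"
    and lim: "\<And>T. uniform_limit {0..T} q f sequentially"
  shows "cadlag f"
proof (rule cadlagI)
  fix t :: real assume t: "0 \<le> t"
  have ev: "eventually (\<lambda>s. s \<in> {0..t + 1}) (at_right t)"
    using t by (intro eventually_at_rightI[of t "t + 1"]) auto
  have "(\<lambda>n. q n t) \<longlonglongrightarrow> f t"
    by (rule tendsto_uniform_limitI[OF lim[of t]]) (use t in auto)
  then show "(f \<longlongrightarrow> f t) (at_right t)"
    by (intro swap_uniform_limit'[OF _ _ lim ev]) (auto intro: always_eventually cadlag_at_right q t)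
next
  fix t :: real assume t: "0 < t"
  then have ev: "eventually (\<lambda>s. s \<in> {0..t}) (at_left t)"
    by (intro eventually_at_leftI[of 0 t]) auto
  have "\<forall>n. \<exists>l. (q n \<longlongrightarrow> l) (at_left t)"
    using q t by (simp add: cadlag_def)
  then obtain l where l: "\<And>n. (q n \<longlongrightarrow> l n) (at_left t)"
    by metis
  have "Cauchy l"
  proof (rule metric_CauchyI)
    fix e :: real assume "0 < e"
    have "uniformly_Cauchy_on {0..t} q"
      using uniformly_convergent_Cauchy lim uniformly_convergent_on_def by blast
    then obtain N where N: "\<And>s m n. s \<in> {0..t} \<Longrightarrow> N \<le> m \<Longrightarrow> N \<le> n \<Longrightarrow> dist (q m s) (q n s) < e / 2"
      using \<open>0 < e\<close> unfolding uniformly_Cauchy_on_def by (meson half_gt_zero)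
    have "dist (l m) (l n) \<le> e / 2" if "N \<le> m" "N \<le> n" for m n
    proof (rule tendsto_upperbound)
      show "((\<lambda>s. dist (q m s) (q n s)) \<longlongrightarrow> dist (l m) (l n)) (at_left t)"
        by (intro tendsto_dist l)
      show "\<forall>\<^sub>F s in at_left t. dist (q m s) (q n s) \<le> e / 2"
        using ev by eventually_elim (intro less_imp_le N that)
    qed simp
    then have "\<forall>m\<ge>N. \<forall>n\<ge>N. dist (l m) (l n) < e"
      using \<open>0 < e\<close> by (smt (verit) field_sum_of_halves)
    then show "\<exists>N. \<forall>m\<ge>N. \<forall>n\<ge>N. dist (l m) (l n) < e" ..
  qed
  then obtain x where "l \<longlonglongrightarrow> x"
    using Cauchy_convergent_iff convergent_def by blast
  then show "\<exists>l. (f \<longlongrightarrow> l) (at_left t)"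
    by (intro exI[of _ x] swap_uniform_limit'[OF _ _ lim ev]) (auto intro: always_eventually l)
qed

section \<open>Convolution with a measure on the half-line\<close>
lemma zero_ext_right_continuous:
  assumes f: "cadlag f"
  shows "(zero_ext f \<longlongrightarrow> zero_ext f x) (at_right x)"
proof (cases "0 \<le> x")
  case True
  then have "eventually (\<lambda>s. f s = zero_ext f s) (at_right x)"
    by (auto simp: eventually_at_filter zero_ext_def)
  with cadlag_at_right[OF f True] True show ?thesis
    by (simp add: zero_ext_def[of f x] tendsto_cong)
next
  case False
  then have "eventually (\<lambda>s. zero_ext f s = 0) (at_right x)"
    by (intro eventually_at_rightI[of x 0]) (auto simp: zero_ext_def)
  with False show ?thesis
    by (simp add: zero_ext_def[of f x] tendsto_eventually)
qed

lemma zero_ext_left_limit: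
  assumes f: "cadlag f"
  shows "\<exists>l. (zero_ext f \<longlongrightarrow> l) (at_left x)"
proof (cases "0 < x")
  case True
  then obtain l where l: "(f \<longlongrightarrow> l) (at_left x)"
    using cadlag_at_left[OF f] by blast
  from True have "eventually (\<lambda>s. f s = zero_ext f s) (at_left x)"
    by (intro eventually_at_leftI[of 0 x]) (auto simp: zero_ext_def)
  with l have "(zero_ext f \<longlongrightarrow> l) (at_left x)"
    by (simp add: tendsto_cong)
  then show ?thesis ..
next
  case False
  then have "eventually (\<lambda>s. zero_ext f s = 0) (at_left x)"
    by (intro eventually_at_leftI[of "x - 1" x]) (auto simp: zero_ext_def)
  then show ?thesis
    using tendsto_eventually by blast
qed

lemma stieltjes_conv_cong:
  assumes "\<And>s. 0 \<le> s \<Longrightarrow> f s = g s"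
  shows "stieltjes_conv f A t = stieltjes_conv g A t"
  unfolding stieltjes_conv_def by (intro set_lebesgue_integral_cong) (auto simp: assms)

lemma stieltjes_conv_negative: "t < 0 \<Longrightarrow> stieltjes_conv f A t = 0"
  by (simp add: stieltjes_conv_def set_lebesgue_integral_def)

text \<open>
  The assumption that the Laplace transform is finite at \<open>1\<close> covers the interarrival distribution and the
  renewal measure alike. It implies local finiteness and is what the weighted estimate below is
  expressed in.
\<close>
locale laplace_measure =
  fixes N :: "real measure"
  assumes sets_eq_borel [simp, measurable_cong]: "sets N = sets borel"
    and AE_nonneg: "AE u in N. 0 \<le> u"
    and laplace_finite: "(\<integral>\<^sup>+u. ennreal (exp (- u)) \<partial>N) < \<infinity>"
begin

lemma space_eq_UNIV [simp]: "space N = UNIV"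
  using sets_eq_imp_space_eq[OF sets_eq_borel] by simp

lemma emeasure_atMost_finite: "emeasure N {..t} < \<infinity>"
proof -
  have "emeasure N {..t} = (\<integral>\<^sup>+u. indicator {..t} u \<partial>N)"
    by simp
  also have "\<dots> \<le> (\<integral>\<^sup>+u. ennreal (exp t) * ennreal (exp (- u)) \<partial>N)"
    by (intro nn_integral_mono)
      (auto simp: indicator_def ennreal_mult[symmetric] exp_minus' exp_diff[symmetric] simp flip: exp_add)
  also have "\<dots> < \<infinity>"
    using laplace_finite by (simp add: nn_integral_cmult ennreal_mult_less_top)
  finally show ?thesis .
qed

lemma emeasure_bounded_above_finite: "A \<in> sets borel \<Longrightarrow> A \<subseteq> {..t} \<Longrightarrow> emeasure N A \<noteq> \<infinity>"
  using emeasure_mono[of A "{..t}" N] emeasure_atMost_finite[of t] by (auto simp: top_unique)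

sublocale sigma_finite_measure N
proof
  show "\<exists>A. countable A \<and> A \<subseteq> sets N \<and> \<Union> A = space N \<and> (\<forall>a\<in>A. emeasure N a \<noteq> \<infinity>)"
    using emeasure_atMost_finite real_arch_simple
    by (intro exI[of _ "range (\<lambda>n. {..real n})"]) (auto simp: less_top[symmetric])
qed

lemma cdf_mono: "x \<le> y \<Longrightarrow> cdf N x \<le> cdf N y"
  unfolding cdf_def
  by (intro measure_mono_fmeasurable)
    (auto simp: fmeasurable_def emeasure_atMost_finite[simplified])

lemma cdf_right_continuous: "continuous (at_right a) (cdf N)"
  unfolding continuous_within
proof (rule tendsto_at_right_sequentially[where b="a + 1"])
  fix f :: "nat \<Rightarrow> real" and x assume f: "decseq f" "f \<longlonglongrightarrow> a"
  then have "(\<lambda>n. cdf N (f n)) \<longlonglongrightarrow> measure N (\<Inter>i. {.. f i})"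
    unfolding cdf_def
    using emeasure_bounded_above_finite[of "{..f i}" "f i" for i]
    by (intro Lim_measure_decseq) (auto simp: decseq_def)
  also have "(\<Inter>i. {.. f i}) = {.. a}"
    using decseq_ge[OF f] by (auto intro: order_trans LIMSEQ_le_const[OF f(2)])
  finally show "(\<lambda>n. cdf N (f n)) \<longlonglongrightarrow> cdf N a"
    by (simp add: cdf_def)
qed simp

text \<open>
  This is what lets integrals against the Stieltjes measures of \<open>F\<close> and of \<open>M\<close> be computed with the
  measures themselves.
\<close>
lemma interval_measure_cdf: "interval_measure (cdf N) = N"
proof (rule measure_eqI_generator_eq[where \<Omega>=UNIV])
  fix X assume "X \<in> range (\<lambda>(a, b). {a<..b::real})"
  then obtain a b where X: "X = {a<..b}" by auto
  show "emeasure (interval_measure (cdf N)) X = emeasure N X"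
  proof (cases "a \<le> b")
    case True
    have "cdf N b = cdf N a + measure N {a<..b}"
      unfolding cdf_def ivl_disj_un(9)[OF True, symmetric]
      by (intro measure_Union emeasure_bounded_above_finite[where t=a]
          emeasure_bounded_above_finite[where t=b]) auto
    moreover have "emeasure N {a<..b} \<noteq> \<infinity>"
      by (rule emeasure_bounded_above_finite[where t=b]) auto
    ultimately have "ennreal (cdf N b - cdf N a) = emeasure N {a<..b}"
      by (simp add: emeasure_eq_ennreal_measure)
    then show ?thesis
      using True by (simp add: X emeasure_interval_measure_Ioc cdf_mono cdf_right_continuous)
  qed (simp add: X)
next
  show "(\<Union>i. {- real (i::nat)<..real i}) = UNIV"
    by (rule UN_Ioc_eq_UNIV)
next
  fix i
  show "emeasure (interval_measure (cdf N)) {- real i<..real i} \<noteq> \<infinity>"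
    by (simp add: emeasure_interval_measure_Ioc cdf_mono cdf_right_continuous)
qed (auto simp: borel_sigma_sets_Ioc Int_stable_def)

lemma stieltjes_conv_cdf:
  assumes f: "locally_bounded_borel f"
  shows "stieltjes_conv f (cdf N) t = (\<integral>u. zero_ext f (t - u) \<partial>N)"
proof -
  note [measurable] = locally_bounded_borel_measurable[OF f]
  have "stieltjes_conv f (cdf N) t = (\<integral>u. indicator {0..} u * zero_ext f (t - u) \<partial>N)"
    unfolding stieltjes_conv_def interval_measure_cdf set_lebesgue_integral_def
    by (intro Bochner_Integration.integral_cong) (auto simp: zero_ext_def indicator_def)
  also have "\<dots> = (\<integral>u. zero_ext f (t - u) \<partial>N)"
    using AE_nonneg by (intro integral_cong_AE) (measurable, auto)
  finally show ?thesis .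
qed

lemma integrable_zero_ext:
  assumes f: "locally_bounded_borel f"
  shows "integrable N (\<lambda>u. zero_ext f (t - u))"
proof -
  note [measurable] = locally_bounded_borel_measurable[OF f]
  obtain B where B: "0 \<le> B" "\<And>s. s \<in> {0..t} \<Longrightarrow> \<bar>f s\<bar> \<le> B"
    using locally_bounded_borel_bound[OF f] by metis
  show ?thesis
  proof (rule integrableI_bounded_set[where A="{..t}" and B=B])
    show "AE u\<in>{..t} in N. norm (zero_ext f (t - u)) \<le> B"
      using AE_nonneg by eventually_elim (auto simp: zero_ext_def intro!: B)
    show "AE u in N. u \<notin> {..t} \<longrightarrow> zero_ext f (t - u) = 0"
      by (simp add: zero_ext_def)
  qed (use emeasure_atMost_finite in auto)
qed

lemma stieltjes_conv_add:
  assumes "locally_bounded_borel f" "locally_bounded_borel g"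
  shows "stieltjes_conv (\<lambda>s. f s + g s) (cdf N) t
    = stieltjes_conv f (cdf N) t + stieltjes_conv g (cdf N) t"
proof -
  have "zero_ext (\<lambda>s. f s + g s) u = zero_ext f u + zero_ext g u" for u
    by (simp add: zero_ext_def)
  then show ?thesis
    using assms
    by (simp add: stieltjes_conv_cdf locally_bounded_borel_add integrable_zero_ext)
qed

lemma stieltjes_conv_cmult:
  assumes "locally_bounded_borel f"
  shows "stieltjes_conv (\<lambda>s. c * f s) (cdf N) t = c * stieltjes_conv f (cdf N) t"
proof -
  have "zero_ext (\<lambda>s. c * f s) u = c * zero_ext f u" for u
    by (simp add: zero_ext_def)
  then show ?thesis
    using assms by (simp add: stieltjes_conv_cdf locally_bounded_borel_cmult)
qed

lemma stieltjes_conv_diff: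
  assumes "locally_bounded_borel f" "locally_bounded_borel g"
  shows "stieltjes_conv (\<lambda>s. f s - g s) (cdf N) t
    = stieltjes_conv f (cdf N) t - stieltjes_conv g (cdf N) t"
  using stieltjes_conv_add[OF assms(1) locally_bounded_borel_cmult[OF assms(2), of "-1"], of t]
    stieltjes_conv_cmult[OF assms(2), of "-1" t] by simp

text \<open>
  With the weight \<open>exp (- s)\<close> on paths, convolution has operator norm at most the Laplace transform at
  \<open>1\<close>, since \<open>exp (t - u) = exp t * exp (- u)\<close>.
\<close>
lemma stieltjes_conv_exp_bound:
  assumes f: "locally_bounded_borel f" and B: "0 \<le> B"
    and le: "\<And>s. s \<in> {0..t} \<Longrightarrow> \<bar>f s\<bar> \<le> B * exp s"
  shows "\<bar>stieltjes_conv f (cdf N) t\<bar> \<le> (\<integral>u. exp (- u) \<partial>N) * B * exp t"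
proof -
  have int: "integrable N (\<lambda>u. exp (- u))"
    using laplace_finite by (intro integrableI_bounded) auto
  have "\<bar>stieltjes_conv f (cdf N) t\<bar> \<le> (\<integral>u. \<bar>zero_ext f (t - u)\<bar> \<partial>N)"
    unfolding stieltjes_conv_cdf[OF f] by simp
  also have "\<dots> \<le> (\<integral>u. (B * exp t) * exp (- u) \<partial>N)"
  proof (intro integral_mono_AE integrable_abs integrable_zero_ext f integrable_mult_right int)
    show "AE u in N. \<bar>zero_ext f (t - u)\<bar> \<le> (B * exp t) * exp (- u)"
      using AE_nonneg
    proof eventually_elim
      case (elim u)
      then show ?case
        using le[of "t - u"] B by (auto simp: zero_ext_def exp_diff exp_minus field_simps)
    qed
  qed
  finally show ?thesis
    by (simp add: mult_ac)
qed

lemma locally_bounded_borel_stieltjes_conv: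
  assumes f: "locally_bounded_borel f"
  shows "locally_bounded_borel (stieltjes_conv f (cdf N))"
proof -
  note [measurable] = locally_bounded_borel_measurable[OF f]
  have "(\<lambda>t. \<integral>u. zero_ext f (t - u) \<partial>N) \<in> borel_measurable borel"
    by measurable
  also have "(\<lambda>t. \<integral>u. zero_ext f (t - u) \<partial>N) = stieltjes_conv f (cdf N)"
    by (simp add: stieltjes_conv_cdf[OF f] fun_eq_iff)
  finally have [measurable]: "stieltjes_conv f (cdf N) \<in> borel_measurable borel" .
  have "zero_ext (stieltjes_conv f (cdf N)) \<in> borel_measurable borel"
    unfolding zero_ext_def[abs_def] by measurable
  moreover have "\<exists>B. \<forall>t\<in>{0..T}. \<bar>stieltjes_conv f (cdf N) t\<bar> \<le> B" for T
  proof -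
    obtain B where B: "0 \<le> B" "\<And>s. s \<in> {0..T} \<Longrightarrow> \<bar>f s\<bar> \<le> B"
      using locally_bounded_borel_bound[OF f] by metis
    have "\<bar>stieltjes_conv f (cdf N) t\<bar> \<le> (\<integral>u. exp (- u) \<partial>N) * B * exp T" if "t \<in> {0..T}" for t
    proof -
      have "\<bar>f s\<bar> \<le> B * exp s" if "s \<in> {0..t}" for s
        using B(2)[of s] B(1) that \<open>t \<in> {0..T}\<close> mult_left_mono[of 1 "exp s" B] by force
      then have "\<bar>stieltjes_conv f (cdf N) t\<bar> \<le> (\<integral>u. exp (- u) \<partial>N) * B * exp t"
        by (intro stieltjes_conv_exp_bound f B(1))
      also have "\<dots> \<le> (\<integral>u. exp (- u) \<partial>N) * B * exp T"
        using that B(1) by (intro mult_left_mono mult_nonneg_nonneg) auto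
      finally show ?thesis .
    qed
    then show ?thesis
      by blast
  qed
  ultimately show ?thesis
    by (simp add: locally_bounded_borel_def)
qed

lemma stieltjes_conv_dominated_convergence:
  assumes f: "cadlag f" and S: "\<And>n. S n \<le> T"
    and lim: "\<And>u. (\<lambda>n. zero_ext f (S n - u)) \<longlonglongrightarrow> g u"
  shows "(\<lambda>n. stieltjes_conv f (cdf N) (S n)) \<longlonglongrightarrow> (\<integral>u. g u \<partial>N)"
proof -
  have f': "locally_bounded_borel f"
    by (rule cadlag_locally_bounded_borel[OF f])
  note [measurable] = locally_bounded_borel_measurable[OF f']
  obtain B where B: "0 \<le> B" "\<And>s. s \<in> {0..T} \<Longrightarrow> \<bar>f s\<bar> \<le> B"
    using locally_bounded_borel_bound[OF f'] by metis
  have "(\<lambda>n. \<integral>u. zero_ext f (S n - u) \<partial>N) \<longlonglongrightarrow> (\<integral>u. g u \<partial>N)"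
  proof (rule integral_dominated_convergence[where w="\<lambda>u. B * indicator {..T} u"])
    show "g \<in> borel_measurable N"
      by (rule borel_measurable_LIMSEQ_real[OF lim]) measurable
    show "integrable N (\<lambda>u. B * indicator {..T} u)"
      using emeasure_atMost_finite[of T] by simp
    show "AE u in N. norm (zero_ext f (S n - u)) \<le> B * indicator {..T} u" for n
      using AE_nonneg
    proof eventually_elim
      case (elim u)
      then show ?case
        using B(2)[of "S n - u"] B(1) S[of n] by (auto simp: zero_ext_def indicator_def)
    qed
  qed (use lim in auto)
  then show ?thesis
    by (simp add: stieltjes_conv_cdf[OF f'])
qed

text \<open>
  If \<open>S n\<close> tends to \<open>t\<close> strictly from one side, then so does \<open>S n - u\<close> to \<open>t - u\<close> for every \<open>u\<close>, and the
  one-sided limits of the path pass through the integral by dominated convergence. From the left the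
  limit is the convolution of the left limits.
\<close>
lemma cadlag_stieltjes_conv:
  assumes f: "cadlag f"
  shows "cadlag (stieltjes_conv f (cdf N))"
proof (rule cadlagI)
  fix t :: real assume "0 \<le> t"
  show "(stieltjes_conv f (cdf N) \<longlongrightarrow> stieltjes_conv f (cdf N) t) (at_right t)"
  proof (rule tendsto_at_right_sequentially[where b="t + 1"])
    fix S assume S: "\<And>n. t < S n" "\<And>n. S n < t + 1" "S \<longlonglongrightarrow> t"
    have "filterlim (\<lambda>n. S n - u) (at_right (t - u)) sequentially" for u
      using S(1) by (auto simp: filterlim_at intro!: always_eventually tendsto_intros S(3) less_imp_neq[symmetric])
    then have "(\<lambda>n. zero_ext f (S n - u)) \<longlonglongrightarrow> zero_ext f (t - u)" for u
      by (rule filterlim_compose[OF zero_ext_right_continuous[OF f]])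
    then show "(\<lambda>n. stieltjes_conv f (cdf N) (S n)) \<longlonglongrightarrow> stieltjes_conv f (cdf N) t"
      unfolding stieltjes_conv_cdf[OF cadlag_locally_bounded_borel[OF f], of t]
      by (rule stieltjes_conv_dominated_convergence[OF f less_imp_le[OF S(2)]])
  qed simp
next
  fix t :: real assume "0 < t"
  obtain g where g: "\<And>x. (zero_ext f \<longlongrightarrow> g x) (at_left x)"
    using zero_ext_left_limit[OF f] by metis
  have "(stieltjes_conv f (cdf N) \<longlongrightarrow> (\<integral>u. g (t - u) \<partial>N)) (at_left t)"
  proof (rule tendsto_at_left_sequentially[where b="t - 1"])
    fix S assume S: "\<And>n. S n < t" "\<And>n. t - 1 < S n" "S \<longlonglongrightarrow> t"
    have "filterlim (\<lambda>n. S n - u) (at_left (t - u)) sequentially" for u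
      using S(1) by (auto simp: filterlim_at intro!: always_eventually tendsto_intros S(3) less_imp_neq)
    then have "(\<lambda>n. zero_ext f (S n - u)) \<longlonglongrightarrow> g (t - u)" for u
      by (rule filterlim_compose[OF g])
    then show "(\<lambda>n. stieltjes_conv f (cdf N) (S n)) \<longlonglongrightarrow> (\<integral>u. g (t - u) \<partial>N)"
      by (rule stieltjes_conv_dominated_convergence[OF f less_imp_le[OF S(1)]])
  qed simp
  then show "\<exists>l. (stieltjes_conv f (cdf N) \<longlongrightarrow> l) (at_left t)" ..
qed

lemma nn_integral_zero_ext:
  assumes f: "locally_bounded_borel f" and nonneg: "\<And>s. 0 \<le> s \<Longrightarrow> 0 \<le> f s"
  shows "(\<integral>\<^sup>+u. ennreal (zero_ext f (t - u)) \<partial>N) = ennreal (stieltjes_conv f (cdf N) t)"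
    and "0 \<le> stieltjes_conv f (cdf N) t"
proof -
  have "0 \<le> zero_ext f s" for s
    by (simp add: zero_ext_def nonneg)
  then show "(\<integral>\<^sup>+u. ennreal (zero_ext f (t - u)) \<partial>N) = ennreal (stieltjes_conv f (cdf N) t)"
    "0 \<le> stieltjes_conv f (cdf N) t"
    by (simp_all add: stieltjes_conv_cdf f nn_integral_eq_integral[OF integrable_zero_ext])
qed

lemma stieltjes_conv_one: "0 \<le> t \<Longrightarrow> stieltjes_conv (\<lambda>_. 1) (cdf N) t = cdf N t"
proof -
  assume "0 \<le> t"
  have "(\<integral>u. zero_ext (\<lambda>_. 1) (t - u) \<partial>N) = (\<integral>u. indicator {..t} u \<partial>N)"
    by (intro Bochner_Integration.integral_cong) (auto simp: zero_ext_def indicator_def)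
  also have "\<dots> = cdf N t"
    by (simp add: cdf_def)
  finally show ?thesis
    by (simp only: stieltjes_conv_cdf locally_bounded_borel_const)
qed

lemma cdf_negative: "t < 0 \<Longrightarrow> cdf N t = 0"
proof -
  assume "t < 0"
  have "AE u in N. u \<notin> {..t}"
    using AE_nonneg by eventually_elim (use \<open>t < 0\<close> in auto)
  then have "emeasure N {u \<in> space N. u \<in> {..t}} = 0"
    by (rule emeasure_eq_0_AE)
  then have "emeasure N {..t} = 0"
    by (simp add: atMost_def)
  then show ?thesis
    by (simp add: cdf_def measure_def)
qed

end

section \<open>The renewal measure\<close>
text \<open>
  The expected number of partial sums \<open>X\<^sub>0 + \<dots> + X\<^sub>n\<close> in a set, for independent \<open>X\<^sub>i\<close> distributed as \<open>\<mu>\<close>.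
  Counting measure on the indices turns the sum over \<open>n\<close> into an image measure. The empty partial sum is
  left out, because a renewal at the origin is not counted.
\<close>
definition renewal_measure :: "real measure \<Rightarrow> real measure" where
  "renewal_measure \<mu> =
     distr (count_space UNIV \<Otimes>\<^sub>M stream_space \<mu>) borel (\<lambda>(n, \<omega>). sum_list (stake (Suc n) \<omega>))"

locale interarrival_law = real_distribution \<mu> for \<mu> :: "real measure" +
  assumes AE_interarrival_nonneg: "AE x in \<mu>. 0 \<le> x"
    and not_AE_zero: "\<not> (AE x in \<mu>. x = 0)"
begin

lemma measure_UNIV: "emeasure \<mu> UNIV = 1" "measure \<mu> UNIV = 1"
  using emeasure_space_1 prob_space by simp_all

sublocale F: laplace_measure \<mu>
proof
  have "(\<integral>\<^sup>+u. ennreal (exp (- u)) \<partial>\<mu>) \<le> (\<integral>\<^sup>+u. 1 \<partial>\<mu>)"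
    using AE_interarrival_nonneg by (intro nn_integral_mono_AE) (auto elim: eventually_mono)
  then show "(\<integral>\<^sup>+u. ennreal (exp (- u)) \<partial>\<mu>) < \<infinity>"
    by (simp add: measure_UNIV le_less_trans)
qed (auto intro: AE_interarrival_nonneg)

definition laplace :: real where
  "laplace = (\<integral>u. exp (- u) \<partial>\<mu>)"

lemma integrable_exp: "integrable \<mu> (\<lambda>u. exp (- u))"
  using F.laplace_finite by (intro integrableI_bounded) auto

lemma laplace_nonneg: "0 \<le> laplace"
  by (simp add: laplace_def)

text \<open>
  This strict inequality is where nondegeneracy of the interarrival law enters; it makes convolution
  with \<open>\<mu>\<close> a contraction and the expected number of renewals finite.
\<close>
lemma laplace_less_1: "laplace < 1"
proof -
  have ge: "AE u in \<mu>. 0 \<le> 1 - exp (- u)"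
    using AE_interarrival_nonneg by eventually_elim simp
  have int: "integrable \<mu> (\<lambda>u. 1 - exp (- u))"
    by (intro Bochner_Integration.integrable_diff integrable_const integrable_exp)
  have eq: "(\<integral>u. 1 - exp (- u) \<partial>\<mu>) = 1 - laplace"
    by (simp add: laplace_def integrable_exp measure_UNIV)
  have "(\<integral>u. 1 - exp (- u) \<partial>\<mu>) \<noteq> 0"
    using not_AE_zero by (simp add: integral_nonneg_eq_0_iff_AE[OF int ge])
  moreover have "0 \<le> (\<integral>u. 1 - exp (- u) \<partial>\<mu>)"
    by (rule integral_nonneg_AE[OF ge])
  ultimately show ?thesis
    unfolding eq by simp
qed

lemma nn_integral_exp: "(\<integral>\<^sup>+u. ennreal (exp (- u)) \<partial>\<mu>) = ennreal laplace"
  unfolding laplace_def by (intro nn_integral_eq_integral integrable_exp) simp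

lemma measurable_sum_list_stake [measurable]:
  "(\<lambda>\<omega>. sum_list (stake n \<omega>)) \<in> borel_measurable (stream_space \<mu>)"
proof (induction n)
  case (Suc n)
  have "(\<lambda>\<omega>. sum_list (stake n (stl \<omega>))) \<in> borel_measurable (stream_space \<mu>)"
    by (rule measurable_compose[OF measurable_stl Suc.IH])
  moreover have "(\<lambda>\<omega>. shd \<omega>) \<in> borel_measurable (stream_space \<mu>)"
    using measurable_shd[of \<mu>] by (simp cong: measurable_cong_sets)
  ultimately show ?case
    by simp
qed simp

lemma nn_integral_first_sum:
  assumes [measurable]: "f \<in> borel_measurable borel"
  shows "(\<integral>\<^sup>+\<omega>. f (sum_list (stake (Suc 0) \<omega>)) \<partial>stream_space \<mu>) = (\<integral>\<^sup>+x. f x \<partial>\<mu>)"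
proof -
  interpret S: prob_space "stream_space \<mu>"
    by (rule prob_space_stream_space)
  show ?thesis
    by (subst nn_integral_stream_space[OF measurable_compose[OF measurable_sum_list_stake assms]])
      (simp add: S.emeasure_space_1)
qed

lemma nn_integral_next_sum:
  assumes [measurable]: "f \<in> borel_measurable borel"
  shows "(\<integral>\<^sup>+\<omega>. f (sum_list (stake (Suc n) \<omega>)) \<partial>stream_space \<mu>)
    = (\<integral>\<^sup>+x. \<integral>\<^sup>+\<omega>. f (x + sum_list (stake n \<omega>)) \<partial>stream_space \<mu> \<partial>\<mu>)"
  by (subst nn_integral_stream_space[OF measurable_compose[OF measurable_sum_list_stake assms]]) simp

lemma nn_integral_renewal_measure:
  assumes [measurable]: "f \<in> borel_measurable borel"
  shows "(\<integral>\<^sup>+u. f u \<partial>renewal_measure \<mu>)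
    = (\<Sum>n. \<integral>\<^sup>+\<omega>. f (sum_list (stake (Suc n) \<omega>)) \<partial>stream_space \<mu>)"
proof -
  interpret S: prob_space "stream_space \<mu>"
    by (rule prob_space_stream_space)
  let ?S = "\<lambda>(n, \<omega>). sum_list (stake (Suc n) \<omega>)"
  have S: "?S \<in> borel_measurable (count_space (UNIV :: nat set) \<Otimes>\<^sub>M stream_space \<mu>)"
    by (intro measurable_pair_measure_countable1) (auto simp del: stake.simps)
  have "(\<integral>\<^sup>+u. f u \<partial>renewal_measure \<mu>) = (\<integral>\<^sup>+z. f (?S z) \<partial>(count_space UNIV \<Otimes>\<^sub>M stream_space \<mu>))"
    unfolding renewal_measure_def by (subst nn_integral_distr[OF S]) simp_all
  also have "\<dots> = (\<integral>\<^sup>+n. \<integral>\<^sup>+\<omega>. f (?S (n, \<omega>)) \<partial>stream_space \<mu> \<partial>count_space UNIV)"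
    by (rule S.nn_integral_fst[OF measurable_compose[OF S assms], symmetric])
  also have "\<dots> = (\<integral>\<^sup>+n. \<integral>\<^sup>+\<omega>. f (sum_list (stake (Suc n) \<omega>)) \<partial>stream_space \<mu> \<partial>count_space UNIV)"
    by (simp only: prod.case)
  finally show ?thesis
    by (simp only: nn_integral_count_space_nat)
qed

lemma sets_renewal_measure [simp, measurable_cong]: "sets (renewal_measure \<mu>) = sets borel"
  by (simp add: renewal_measure_def)

text \<open>
  The partial sum of \<open>n + 1\<close> interarrival times has Laplace transform \<open>laplace ^ (n + 1)\<close>, and these terms
  form a convergent geometric series.
\<close>
sublocale M: laplace_measure "renewal_measure \<mu>"
proof
  have "(\<integral>\<^sup>+\<omega>. indicator {..<0} (sum_list (stake (Suc n) \<omega>)) \<partial>stream_space \<mu>) = 0" for n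
  proof (induction n)
    case 0
    have "(\<integral>\<^sup>+x. indicator {..<0::real} x \<partial>\<mu>) = (\<integral>\<^sup>+x. 0 \<partial>\<mu>)"
      using AE_interarrival_nonneg
      by (intro nn_integral_cong_AE) (auto elim!: eventually_mono simp: indicator_def)
    then show ?case
      by (subst nn_integral_first_sum) auto
  next
    case (Suc n)
    have "(\<integral>\<^sup>+x. \<integral>\<^sup>+\<omega>. indicator {..<0} (x + sum_list (stake (Suc n) \<omega>)) \<partial>stream_space \<mu> \<partial>\<mu>)
        \<le> (\<integral>\<^sup>+x. \<integral>\<^sup>+\<omega>. indicator {..<0} (sum_list (stake (Suc n) \<omega>)) \<partial>stream_space \<mu> \<partial>\<mu>)"
      using AE_interarrival_nonneg
      by (intro nn_integral_mono_AE)
        (auto elim!: eventually_mono simp: indicator_def intro!: nn_integral_mono simp del: stake.simps)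
    then show ?case
      by (subst nn_integral_next_sum) (simp_all add: Suc.IH del: stake.simps)
  qed
  then have "(\<integral>\<^sup>+u. indicator {..<0} u \<partial>renewal_measure \<mu>) = 0"
    by (subst nn_integral_renewal_measure) (auto simp del: stake.simps)
  then have "emeasure (renewal_measure \<mu>) {..<0} = 0"
    by simp
  then show "AE u in renewal_measure \<mu>. 0 \<le> u"
    by (intro AE_I[of _ _ "{..<0}"]) auto
next
  have "(\<integral>\<^sup>+\<omega>. ennreal (exp (- sum_list (stake (Suc n) \<omega>))) \<partial>stream_space \<mu>)
      = ennreal (laplace ^ Suc n)" for n
  proof (induction n)
    case 0
    show ?case
      by (subst nn_integral_first_sum) (auto simp: nn_integral_exp)
  next
    case (Suc n)
    have "(\<integral>\<^sup>+\<omega>. ennreal (exp (- (x + sum_list (stake (Suc n) \<omega>)))) \<partial>stream_space \<mu>)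
        = ennreal (laplace ^ Suc n) * ennreal (exp (- x))" for x
    proof -
      have "(\<integral>\<^sup>+\<omega>. ennreal (exp (- (x + sum_list (stake (Suc n) \<omega>)))) \<partial>stream_space \<mu>)
          = (\<integral>\<^sup>+\<omega>. ennreal (exp (- x)) * ennreal (exp (- sum_list (stake (Suc n) \<omega>))) \<partial>stream_space \<mu>)"
        by (simp add: ennreal_mult[symmetric] exp_add[symmetric] del: stake.simps)
      also have "\<dots> = ennreal (exp (- x)) * ennreal (laplace ^ Suc n)"
        by (subst nn_integral_cmult) (simp_all add: Suc.IH del: stake.simps power_Suc)
      finally show ?thesis
        by (simp add: mult.commute)
    qed
    moreover have exp: "(\<lambda>u. ennreal (exp (- u))) \<in> borel_measurable borel"
      by measurable
    ultimately have "(\<integral>\<^sup>+\<omega>. ennreal (exp (- sum_list (stake (Suc (Suc n)) \<omega>))) \<partial>stream_space \<mu>)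
        = (\<integral>\<^sup>+x. ennreal (laplace ^ Suc n) * ennreal (exp (- x)) \<partial>\<mu>)"
      by (simp only: nn_integral_next_sum[OF exp, of "Suc n"])
    also have "\<dots> = ennreal (laplace ^ Suc n) * ennreal laplace"
      by (simp add: nn_integral_cmult nn_integral_exp)
    also have "\<dots> = ennreal (laplace ^ Suc (Suc n))"
      using laplace_nonneg by (simp add: ennreal_mult[symmetric] mult_ac)
    finally show ?case .
  qed
  then have "(\<integral>\<^sup>+u. ennreal (exp (- u)) \<partial>renewal_measure \<mu>) = (\<Sum>n. ennreal (laplace ^ Suc n))"
    by (subst nn_integral_renewal_measure) (auto simp del: stake.simps power_Suc)
  also have "\<dots> = ennreal (\<Sum>n. laplace ^ Suc n)"
    using laplace_nonneg laplace_less_1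
    by (intro suminf_ennreal2) (auto intro!: summable_mult summable_geometric)
  finally show "(\<integral>\<^sup>+u. ennreal (exp (- u)) \<partial>renewal_measure \<mu>) < \<infinity>"
    by simp
qed simp

text \<open>
  The identity \<open>dM = dF + dM * dF\<close>, obtained by conditioning on the first interarrival time: the later
  renewals, seen from the first one, are again a renewal process.
\<close>
lemma nn_integral_renewal_measure_first_step:
  assumes [measurable]: "f \<in> borel_measurable borel"
  shows "(\<integral>\<^sup>+u. f u \<partial>renewal_measure \<mu>)
    = (\<integral>\<^sup>+x. f x \<partial>\<mu>) + (\<integral>\<^sup>+x. \<integral>\<^sup>+y. f (x + y) \<partial>renewal_measure \<mu> \<partial>\<mu>)"
proof -
  interpret S: prob_space "stream_space \<mu>"
    by (rule prob_space_stream_space)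
  define a where "a n = (\<integral>\<^sup>+\<omega>. f (sum_list (stake (Suc n) \<omega>)) \<partial>stream_space \<mu>)" for n
  have "(\<integral>\<^sup>+x. \<integral>\<^sup>+y. f (x + y) \<partial>renewal_measure \<mu> \<partial>\<mu>)
      = (\<integral>\<^sup>+x. (\<Sum>n. \<integral>\<^sup>+\<omega>. f (x + sum_list (stake (Suc n) \<omega>)) \<partial>stream_space \<mu>) \<partial>\<mu>)"
    by (subst nn_integral_renewal_measure) (auto simp del: stake.simps)
  also have "\<dots> = (\<Sum>n. \<integral>\<^sup>+x. \<integral>\<^sup>+\<omega>. f (x + sum_list (stake (Suc n) \<omega>)) \<partial>stream_space \<mu> \<partial>\<mu>)"
    by (rule nn_integral_suminf) measurable
  also have "\<dots> = (\<Sum>n. a (Suc n))"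
    unfolding a_def by (subst (2) nn_integral_next_sum) (auto simp del: stake.simps)
  finally have step: "(\<integral>\<^sup>+x. \<integral>\<^sup>+y. f (x + y) \<partial>renewal_measure \<mu> \<partial>\<mu>) = (\<Sum>n. a (Suc n))" .
  have "(\<integral>\<^sup>+u. f u \<partial>renewal_measure \<mu>) = (\<Sum>n. a n)"
    unfolding a_def by (rule nn_integral_renewal_measure) measurable
  also have "\<dots> = a 0 + (\<Sum>n. a (Suc n))"
    using suminf_offset[of a 1] by simp
  also have "a 0 = (\<integral>\<^sup>+x. f x \<partial>\<mu>)"
    unfolding a_def by (rule nn_integral_first_sum) measurable
  finally show ?thesis
    unfolding step .
qed

text \<open>
  The operator form \<open>D = C + C D\<close> of the preceding identity. Nonnegative paths come first, because
  there the iterated integral needs no integrability argument.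
\<close>
lemma stieltjes_conv_renewal_nonneg:
  assumes f: "locally_bounded_borel f" and nonneg: "\<And>s. 0 \<le> s \<Longrightarrow> 0 \<le> f s"
  shows "stieltjes_conv f (cdf (renewal_measure \<mu>)) t
    = stieltjes_conv f (cdf \<mu>) t + stieltjes_conv (stieltjes_conv f (cdf (renewal_measure \<mu>))) (cdf \<mu>) t"
proof -
  let ?D = "stieltjes_conv f (cdf (renewal_measure \<mu>))"
  note [measurable] = locally_bounded_borel_measurable[OF f]
  have D: "locally_bounded_borel ?D"
    by (rule M.locally_bounded_borel_stieltjes_conv[OF f])
  have D_nonneg: "0 \<le> ?D s" for s
    by (rule M.nn_integral_zero_ext(2)[OF f nonneg])
  have ext: "zero_ext ?D = ?D"
    by (auto simp: zero_ext_def fun_eq_iff stieltjes_conv_negative)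
  have "ennreal (?D t) = (\<integral>\<^sup>+u. ennreal (zero_ext f (t - u)) \<partial>renewal_measure \<mu>)"
    by (rule M.nn_integral_zero_ext(1)[OF f nonneg, symmetric])
  also have "\<dots> = (\<integral>\<^sup>+u. ennreal (zero_ext f (t - u)) \<partial>\<mu>)
      + (\<integral>\<^sup>+x. \<integral>\<^sup>+y. ennreal (zero_ext f (t - (x + y))) \<partial>renewal_measure \<mu> \<partial>\<mu>)"
    by (rule nn_integral_renewal_measure_first_step) measurable
  also have "(\<integral>\<^sup>+x. \<integral>\<^sup>+y. ennreal (zero_ext f (t - (x + y))) \<partial>renewal_measure \<mu> \<partial>\<mu>)
      = (\<integral>\<^sup>+x. ennreal (zero_ext ?D (t - x)) \<partial>\<mu>)"
    by (simp add: diff_diff_eq[symmetric] M.nn_integral_zero_ext(1)[OF f nonneg] ext)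
  also have "(\<integral>\<^sup>+u. ennreal (zero_ext f (t - u)) \<partial>\<mu>) + \<dots>
      = ennreal (stieltjes_conv f (cdf \<mu>) t + stieltjes_conv ?D (cdf \<mu>) t)"
    using F.nn_integral_zero_ext[OF f nonneg] F.nn_integral_zero_ext[OF D D_nonneg]
    by (simp add: ennreal_plus)
  finally show ?thesis
    using D_nonneg F.nn_integral_zero_ext(2)[OF f nonneg] F.nn_integral_zero_ext(2)[OF D D_nonneg]
    by (simp only: ennreal_inj add_nonneg_nonneg)
qed

lemma stieltjes_conv_renewal:
  assumes f: "locally_bounded_borel f"
  shows "stieltjes_conv f (cdf (renewal_measure \<mu>)) t
    = stieltjes_conv f (cdf \<mu>) t + stieltjes_conv (stieltjes_conv f (cdf (renewal_measure \<mu>))) (cdf \<mu>) t"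
proof -
  let ?p = "\<lambda>s. max (f s) 0" and ?n = "\<lambda>s. max (-1 * f s) 0"
  let ?D = "\<lambda>f. stieltjes_conv f (cdf (renewal_measure \<mu>))" and ?C = "\<lambda>f. stieltjes_conv f (cdf \<mu>)"
  have p: "locally_bounded_borel ?p" and n: "locally_bounded_borel ?n"
    by (intro locally_bounded_borel_max locally_bounded_borel_cmult f)+
  have split: "f = (\<lambda>s. ?p s - ?n s)"
    by (auto simp: fun_eq_iff)
  have D: "?D f = (\<lambda>s. ?D ?p s - ?D ?n s)"
    by (subst split) (rule ext, rule M.stieltjes_conv_diff[OF p n])
  have "?C f t = ?C ?p t - ?C ?n t"
    by (subst split) (rule F.stieltjes_conv_diff[OF p n])
  moreover have "?C (?D f) t = ?C (?D ?p) t - ?C (?D ?n) t"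
    unfolding D
    by (intro F.stieltjes_conv_diff M.locally_bounded_borel_stieltjes_conv p n)
  moreover have "?D ?p t = ?C ?p t + ?C (?D ?p) t" "?D ?n t = ?C ?n t + ?C (?D ?n) t"
    by (intro stieltjes_conv_renewal_nonneg p n; simp)+
  ultimately show ?thesis
    unfolding D by simp
qed

section \<open>The contraction estimate and the renewal function\<close>
text \<open>
  The common estimate behind uniqueness, where \<open>d\<close> is a constant sequence, and behind the convergence of
  Picard iterates, where \<open>d n\<close> is the difference of two successive ones. For the queue equation \<open>e n\<close> is
  the corresponding difference of positive parts.
\<close>
lemma stieltjes_conv_geometric_decay:
  assumes e: "\<And>n. locally_bounded_borel (e n)"
    and le: "\<And>n s. s \<in> {0..T} \<Longrightarrow> \<bar>e n s\<bar> \<le> \<bar>d n s\<bar>"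
    and eq: "\<And>n s. s \<in> {0..T} \<Longrightarrow> d (Suc n) s = stieltjes_conv (e n) (cdf \<mu>) s"
    and B: "0 \<le> B" "\<And>s. s \<in> {0..T} \<Longrightarrow> \<bar>d 0 s\<bar> \<le> B"
    and t: "t \<in> {0..T}"
  shows "\<bar>d n t\<bar> \<le> laplace ^ n * (B * exp T)"
proof -
  \<comment> \<open>The induction needs the weight \<open>exp s\<close>; it is replaced by its maximum only afterwards.\<close>
  have "\<forall>s\<in>{0..T}. \<bar>d n s\<bar> \<le> laplace ^ n * B * exp s"
  proof (induction n)
    case 0
    have "B * 1 \<le> B * exp s" if "s \<in> {0..T}" for s
      using that B(1) by (intro mult_left_mono) auto
    then show ?case
      using B(2) by fastforce
  next
    case (Suc n)
    show ?case
    proof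
      fix s assume s: "s \<in> {0..T}"
      have "\<bar>e n r\<bar> \<le> (laplace ^ n * B) * exp r" if "r \<in> {0..s}" for r
        using le[of r n] Suc.IH that s by (force intro: order_trans)
      then have "\<bar>stieltjes_conv (e n) (cdf \<mu>) s\<bar> \<le> (\<integral>u. exp (- u) \<partial>\<mu>) * (laplace ^ n * B) * exp s"
        using B(1) laplace_nonneg by (intro F.stieltjes_conv_exp_bound[OF e]) auto
      then show "\<bar>d (Suc n) s\<bar> \<le> laplace ^ Suc n * B * exp s"
        using eq[OF s, of n] by (simp add: laplace_def mult_ac)
    qed
  qed
  then have "\<bar>d n t\<bar> \<le> laplace ^ n * B * exp t"
    using t by blast
  also have "\<dots> \<le> laplace ^ n * B * exp T"
    using t B(1) laplace_nonneg by (intro mult_left_mono) auto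
  finally show ?thesis
    by (simp add: mult_ac)
qed

text \<open>
  For \<open>e = d\<close> this is injectivity of \<open>1 - C\<close>. The general form serves nonexpansive nonlinearities such
  as the positive part.
\<close>
lemma stieltjes_conv_contraction_zero:
  assumes d: "locally_bounded_borel d" and e: "locally_bounded_borel e"
    and le: "\<And>s. 0 \<le> s \<Longrightarrow> \<bar>e s\<bar> \<le> \<bar>d s\<bar>"
    and eq: "\<And>s. 0 \<le> s \<Longrightarrow> d s = stieltjes_conv e (cdf \<mu>) s"
    and t: "0 \<le> t"
  shows "d t = 0"
proof -
  obtain B where B: "0 \<le> B" "\<And>s. s \<in> {0..t} \<Longrightarrow> \<bar>d s\<bar> \<le> B"
    using locally_bounded_borel_bound[OF d] by metis
  have "\<bar>d t\<bar> \<le> laplace ^ n * (B * exp t)" for n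
    by (rule stieltjes_conv_geometric_decay[where d="\<lambda>_. d" and e="\<lambda>_. e", OF e _ _ B])
      (use le eq t in auto)
  moreover have "(\<lambda>n. laplace ^ n * (B * exp t)) \<longlonglongrightarrow> 0 * (B * exp t)"
    using laplace_nonneg laplace_less_1 by (intro tendsto_mult tendsto_const LIMSEQ_realpow_zero)
  ultimately have "\<bar>d t\<bar> \<le> 0"
    using LIMSEQ_le_const[of "\<lambda>n. laplace ^ n * (B * exp t)" 0 "\<bar>d t\<bar>"] by auto
  then show ?thesis
    by simp
qed

text \<open>
  The renewal equation is \<open>D 1 = C 1 + C (D 1)\<close>, because convolving the constant \<open>1\<close> gives the
  distribution functions. Its uniqueness is injectivity of \<open>1 - C\<close>.
\<close>
lemma renewal_function_cdf: "renewal_function (cdf \<mu>) = cdf (renewal_measure \<mu>)"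
  unfolding renewal_function_def
proof (rule the_equality)
  let ?M = "cdf (renewal_measure \<mu>)"
  have one: "locally_bounded_borel (\<lambda>_. 1)"
    by (rule locally_bounded_borel_const)
  have M_eq: "?M t = cdf \<mu> t + stieltjes_conv ?M (cdf \<mu>) t" if "0 \<le> t" for t
  proof -
    have "stieltjes_conv (stieltjes_conv (\<lambda>_. 1) ?M) (cdf \<mu>) t = stieltjes_conv ?M (cdf \<mu>) t"
      by (rule stieltjes_conv_cong) (rule M.stieltjes_conv_one)
    then show ?thesis
      using stieltjes_conv_renewal[OF one, of t] M.stieltjes_conv_one[OF that] F.stieltjes_conv_one[OF that]
      by simp
  qed
  show "solves_renewal_equation (cdf \<mu>) ?M"
    unfolding solves_renewal_equation_def
  proof (intro conjI allI impI)
    show "?M \<in> borel_measurable borel"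
      by (intro borel_measurable_mono monoI M.cdf_mono)
    show "bounded (?M ` {0..T})" for T
      by (rule boundedI[of _ "?M T"]) (auto simp: cdf_def intro: M.cdf_mono[unfolded cdf_def])
  qed (auto simp: M.cdf_negative intro: M_eq)
  have M_lbb: "locally_bounded_borel ?M"
    by (rule locally_bounded_borel_cong[OF M.locally_bounded_borel_stieltjes_conv[OF one]])
      (rule M.stieltjes_conv_one)
  fix M assume M: "solves_renewal_equation (cdf \<mu>) M"
  have "zero_ext M = M"
    using M by (auto simp: zero_ext_def solves_renewal_equation_def fun_eq_iff)
  moreover have "\<exists>B. \<forall>t\<in>{0..T}. \<bar>M t\<bar> \<le> B" for T
  proof (cases "0 \<le> T")
    case True
    then have "bounded (M ` {0..T})"
      using M unfolding solves_renewal_equation_def by blast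
    then show ?thesis
      by (auto simp: bounded_iff)
  qed auto
  ultimately have lbb: "locally_bounded_borel M"
    using M by (simp add: locally_bounded_borel_def solves_renewal_equation_def)
  show "M = ?M"
  proof
    fix t
    show "M t = ?M t"
    proof (cases "0 \<le> t")
      case True
      have "M t - ?M t = 0"
      proof (rule stieltjes_conv_contraction_zero[OF _ _ order_refl _ True])
        show "locally_bounded_borel (\<lambda>t. M t - ?M t)"
          by (rule locally_bounded_borel_diff[OF lbb M_lbb])
        then show "locally_bounded_borel (\<lambda>t. M t - ?M t)" .
        show "M s - ?M s = stieltjes_conv (\<lambda>t. M t - ?M t) (cdf \<mu>) s" if "0 \<le> s" for s
          using M M_eq[OF that] that
          by (simp add: solves_renewal_equation_def F.stieltjes_conv_diff[OF lbb M_lbb])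
      qed
      then show ?thesis
        by simp
    qed (use M in \<open>simp add: solves_renewal_equation_def M.cdf_negative\<close>)
  qed
qed

section \<open>The pathwise equivalence\<close>
text \<open>
  With \<open>r\<close> the right-hand side of the second equation, \<open>D = C + C D\<close> cancels every convolution with the
  renewal measure in \<open>r - C r\<close>, leaving \<open>z - (w - C w) - C q\<^sup>-\<close>. As \<open>C q\<^sup>+ = C q - C q\<^sup>-\<close>, the first
  equation thus says that \<open>q - r = C (q - r)\<close>, which by injectivity of \<open>1 - C\<close> means \<open>q = r\<close>.
  The drift is kept as a general path \<open>w\<close>; the diffusion limit has \<open>w t = \<beta> * t\<close>.
\<close>
lemma renewal_resolvent_equivalence:
  assumes q: "locally_bounded_borel q" and z: "locally_bounded_borel z" and w: "locally_bounded_borel w"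
  shows "(\<forall>t\<ge>0. q t = z t - (w t - stieltjes_conv w (cdf \<mu>) t)
            + stieltjes_conv (\<lambda>s. max (q s) 0) (cdf \<mu>) t)
     \<longleftrightarrow> (\<forall>t\<ge>0. q t = z t + stieltjes_conv z (cdf (renewal_measure \<mu>)) t - w t
            - stieltjes_conv (\<lambda>s. min (q s) 0) (cdf (renewal_measure \<mu>)) t)"
    (is "?EqF \<longleftrightarrow> ?EqM")
proof -
  define C where "C f = stieltjes_conv f (cdf \<mu>)" for f
  define D where "D f = stieltjes_conv f (cdf (renewal_measure \<mu>))" for f
  let ?qp = "\<lambda>s. max (q s) 0" and ?qm = "\<lambda>s. min (q s) 0"
  have qm: "locally_bounded_borel ?qm" and qp: "locally_bounded_borel ?qp"
    by (intro locally_bounded_borel_min locally_bounded_borel_max q)+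
  have lbb_D: "locally_bounded_borel (D f)" if "locally_bounded_borel f" for f
    unfolding D_def by (intro M.locally_bounded_borel_stieltjes_conv that)
  define r where "r t = z t + D z t - w t - D ?qm t" for t
  have r: "locally_bounded_borel r"
    unfolding r_def[abs_def]
    by (intro locally_bounded_borel_add locally_bounded_borel_diff lbb_D z w qm)
  have D_eq: "D f t = C f t + C (D f) t" if "locally_bounded_borel f" for f t
    unfolding C_def D_def by (rule stieltjes_conv_renewal[OF that])
  have Cr: "C r t = C z t + C (D z) t - C w t - C (D ?qm) t" for t
    unfolding r_def[abs_def] C_def
    by (simp add: F.stieltjes_conv_diff F.stieltjes_conv_add locally_bounded_borel_add
        locally_bounded_borel_diff lbb_D z w qm)
  have r_eq: "r t = z t - (w t - C w t) - C ?qm t + C r t" for t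
    using D_eq[OF z, of t] D_eq[OF qm, of t] unfolding Cr by (simp add: r_def)
  have Cqp: "C ?qp t = C q t - C ?qm t" for t
  proof -
    have "?qp = (\<lambda>s. q s - ?qm s)"
      by (auto simp: fun_eq_iff)
    then show ?thesis
      using F.stieltjes_conv_diff[OF q qm, of t] by (simp add: C_def)
  qed
  have "?EqF \<longleftrightarrow> (\<forall>t\<ge>0. q t = z t - (w t - C w t) + C ?qp t)"
    by (simp add: C_def)
  also have "\<dots> \<longleftrightarrow> (\<forall>t\<ge>0. q t = r t)"
  proof
    assume eq: "\<forall>t\<ge>0. q t = z t - (w t - C w t) + C ?qp t"
    show "\<forall>t\<ge>0. q t = r t"
    proof (intro allI impI)
      fix t :: real assume t: "0 \<le> t"
      have qr: "locally_bounded_borel (\<lambda>t. q t - r t)"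
        by (rule locally_bounded_borel_diff[OF q r])
      have "q s - r s = stieltjes_conv (\<lambda>t. q t - r t) (cdf \<mu>) s" if "0 \<le> s" for s
        using eq that r_eq[of s] Cqp[of s] F.stieltjes_conv_diff[OF q r, of s] by (simp add: C_def)
      from stieltjes_conv_contraction_zero[OF qr qr order_refl this t]
      show "q t = r t"
        by simp
    qed
  next
    assume eq: "\<forall>t\<ge>0. q t = r t"
    then have "C q t = C r t" for t
      unfolding C_def by (intro stieltjes_conv_cong) simp
    with eq show "\<forall>t\<ge>0. q t = z t - (w t - C w t) + C ?qp t"
      using r_eq Cqp by simp
  qed
  also have "\<dots> \<longleftrightarrow> ?EqM"
    by (simp add: r_def D_def)
  finally show ?thesis .
qed

text \<open>
  By Tonelli both \<open>C id\<close> and the integral of \<open>F\<close> over \<open>[0, t]\<close> measure the region \<open>0 \<le> u \<le> s \<le> t\<close> under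
  \<open>dF(u) ds\<close>. Hence \<open>F\<^sub>e = id - C id\<close>.
\<close>
lemma integrated_tail:
  assumes t: "0 \<le> t"
  shows "(LBINT u:{0..t}. 1 - cdf \<mu> u) = t - stieltjes_conv (\<lambda>s. s) (cdf \<mu>) t"
proof -
  interpret pair_sigma_finite \<mu> lborel ..
  have [measurable]: "cdf \<mu> \<in> borel_measurable borel"
    by (intro borel_measurable_mono monoI F.cdf_mono)
  have int: "set_integrable lborel {0..t} (cdf \<mu>)"
    unfolding set_integrable_def
    by (rule integrableI_bounded_set_indicator[where B=1])
      (auto simp: cdf_nonneg cdf_bounded_prob emeasure_lborel_Icc_eq)
  have "ennreal (stieltjes_conv (\<lambda>s. s) (cdf \<mu>) t) = (\<integral>\<^sup>+u. ennreal (zero_ext (\<lambda>s. s) (t - u)) \<partial>\<mu>)"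
    by (rule F.nn_integral_zero_ext(1)[OF locally_bounded_borel_ident, symmetric]) simp
  also have "\<dots> = (\<integral>\<^sup>+u. \<integral>\<^sup>+s. indicator {0..t} s * indicator {u..} s \<partial>lborel \<partial>\<mu>)"
  proof (rule nn_integral_cong_AE)
    show "AE u in \<mu>. ennreal (zero_ext (\<lambda>s. s) (t - u))
        = (\<integral>\<^sup>+s. indicator {0..t} s * indicator {u..} s \<partial>lborel)"
      using AE_interarrival_nonneg
    proof eventually_elim
      case (elim u)
      then have "(\<integral>\<^sup>+s. indicator {0..t} s * indicator {u..} s \<partial>lborel) = (\<integral>\<^sup>+s. indicator {u..t} s \<partial>lborel)"
        by (intro nn_integral_cong) (auto simp: indicator_def)
      also have "\<dots> = ennreal (zero_ext (\<lambda>s. s) (t - u))"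
        by (auto simp: zero_ext_def)
      finally show ?case ..
    qed
  qed
  also have "\<dots> = (\<integral>\<^sup>+s. \<integral>\<^sup>+u. indicator {0..t} s * indicator {..s} u \<partial>\<mu> \<partial>lborel)"
    by (subst Fubini') (auto intro!: nn_integral_cong simp: indicator_def)
  also have "\<dots> = (\<integral>\<^sup>+s. ennreal (indicator {0..t} s * cdf \<mu> s) \<partial>lborel)"
    by (intro nn_integral_cong, subst nn_integral_cmult_indicator)
      (auto simp: cdf_def emeasure_eq_measure split: split_indicator)
  also have "\<dots> = ennreal (LBINT s:{0..t}. cdf \<mu> s)"
    using int unfolding set_lebesgue_integral_def set_integrable_def
    by (subst nn_integral_eq_integral) (auto simp: cdf_nonneg)
  finally have "stieltjes_conv (\<lambda>s. s) (cdf \<mu>) t = (LBINT s:{0..t}. cdf \<mu> s)"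
    using F.nn_integral_zero_ext(2)[OF locally_bounded_borel_ident, of t]
    by (subst (asm) ennreal_inj) (auto simp: set_lebesgue_integral_def cdf_nonneg intro!: integral_nonneg_AE)
  moreover have "(LBINT u:{0..t}. 1 - cdf \<mu> u) = (LBINT u:{0..t}. 1) - (LBINT u:{0..t}. cdf \<mu> u)"
    by (rule set_integral_diff(2)[OF _ int]) (simp add: set_integrable_def emeasure_lborel_Icc_eq)
  ultimately show ?thesis
    using t by (simp add: set_lebesgue_integral_def)
qed

text \<open>
  The value is the expectation of the minimum of \<open>t\<close> and the interarrival time. For mean \<open>1\<close> it lies in
  the time domain of the Brownian bridge.
\<close>
lemma integrated_tail_bounds:
  assumes t: "0 \<le> t" and mean: "has_bochner_integral \<mu> (\<lambda>x. x) m"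
  shows "t - stieltjes_conv (\<lambda>s. s) (cdf \<mu>) t \<in> {0..m}"
proof -
  note int = F.integrable_zero_ext[OF locally_bounded_borel_ident, of t]
  have eq: "t - stieltjes_conv (\<lambda>s. s) (cdf \<mu>) t = (\<integral>u. t - zero_ext (\<lambda>s. s) (t - u) \<partial>\<mu>)"
    using int by (simp add: F.stieltjes_conv_cdf[OF locally_bounded_borel_ident] measure_UNIV)
  have "(\<integral>u. t - zero_ext (\<lambda>s. s) (t - u) \<partial>\<mu>) \<le> (\<integral>u. u \<partial>\<mu>)"
    using AE_interarrival_nonneg t mean
    by (intro integral_mono_AE Bochner_Integration.integrable_diff int)
      (auto elim!: eventually_mono simp: zero_ext_def has_bochner_integral_iff)
  moreover have "0 \<le> (\<integral>u. t - zero_ext (\<lambda>s. s) (t - u) \<partial>\<mu>)"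
    using AE_interarrival_nonneg t
    by (intro integral_nonneg_AE) (auto elim!: eventually_mono simp: zero_ext_def)
  ultimately show ?thesis
    using mean by (simp add: eq has_bochner_integral_iff)
qed

end

section \<open>Strong solutions\<close>
primrec picard :: "(real \<Rightarrow> real) \<Rightarrow> (real \<Rightarrow> real) \<Rightarrow> nat \<Rightarrow> real \<Rightarrow> real" where
  "picard A y 0 = y"
| "picard A y (Suc n) = (\<lambda>t. y t + stieltjes_conv (\<lambda>s. max (picard A y n s) 0) A t)"

text \<open>
  Right continuity of the paths gives joint measurability in time and sample point, hence measurability
  of the integral over time.
\<close>
lemma (in laplace_measure) borel_measurable_stieltjes_conv_process:
  assumes meas: "\<And>t. 0 \<le> t \<Longrightarrow> X t \<in> borel_measurable P"
    and cadlag: "\<And>\<omega>. \<omega> \<in> space P \<Longrightarrow> cadlag (\<lambda>t. X t \<omega>)"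
  shows "(\<lambda>\<omega>. stieltjes_conv (\<lambda>s. X s \<omega>) (cdf N) t) \<in> borel_measurable P"
proof -
  have "(\<lambda>(t, \<omega>). zero_ext (\<lambda>s. X s \<omega>) t) \<in> borel_measurable (borel \<Otimes>\<^sub>M P)"
    by (intro borel_measurable_right_continuous_process meas cadlag_at_right cadlag)
  then have "(\<lambda>z. case (t - snd z, fst z) of (t, \<omega>) \<Rightarrow> zero_ext (\<lambda>s. X s \<omega>) t) \<in> borel_measurable (P \<Otimes>\<^sub>M N)"
    by (rule measurable_compose[rotated]) measurable
  then have "(\<lambda>\<omega>. \<integral>u. zero_ext (\<lambda>s. X s \<omega>) (t - u) \<partial>N) \<in> borel_measurable P"
    by (intro borel_measurable_lebesgue_integral) (simp add: split_beta')
  then show ?thesis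
    by (rule measurable_cong[THEN iffD1, rotated])
      (simp add: stieltjes_conv_cdf cadlag_locally_bounded_borel cadlag)
qed

context interarrival_law
begin

lemma cadlag_picard: "cadlag y \<Longrightarrow> cadlag (picard (cdf \<mu>) y n)"
  by (induction n) (auto intro!: cadlag_add F.cadlag_stieltjes_conv cadlag_max)

lemma picard_step_bound:
  assumes y: "cadlag y"
  obtains B where "0 \<le> B"
    "\<And>n t. t \<in> {0..T} \<Longrightarrow> \<bar>picard (cdf \<mu>) y (Suc n) t - picard (cdf \<mu>) y n t\<bar> \<le> laplace ^ n * B"
proof -
  let ?p = "picard (cdf \<mu>) y" and ?pp = "\<lambda>n s. max (picard (cdf \<mu>) y n s) 0"
  have pp: "locally_bounded_borel (?pp n)" for n
    by (intro locally_bounded_borel_max cadlag_locally_bounded_borel cadlag_picard y)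
  have p: "locally_bounded_borel (?p n)" for n
    by (intro cadlag_locally_bounded_borel cadlag_picard y)
  obtain B where B: "0 \<le> B" "\<And>t. t \<in> {0..T} \<Longrightarrow> \<bar>?p (Suc 0) t - ?p 0 t\<bar> \<le> B"
    using locally_bounded_borel_bound[OF locally_bounded_borel_diff[OF p p]] by metis
  have "\<bar>?p (Suc n) t - ?p n t\<bar> \<le> laplace ^ n * (B * exp T)" if "t \<in> {0..T}" for n t
  proof (rule stieltjes_conv_geometric_decay[where d="\<lambda>n t. ?p (Suc n) t - ?p n t"
        and e="\<lambda>n s. ?pp (Suc n) s - ?pp n s", OF _ _ _ B that])
    show "locally_bounded_borel (\<lambda>s. ?pp (Suc n) s - ?pp n s)" for n
      by (rule locally_bounded_borel_diff[OF pp pp])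
    show "\<bar>?pp (Suc n) s - ?pp n s\<bar> \<le> \<bar>?p (Suc n) s - ?p n s\<bar>" for n s
      by (simp only: max_def) auto
    show "?p (Suc (Suc n)) s - ?p (Suc n) s = stieltjes_conv (\<lambda>s. ?pp (Suc n) s - ?pp n s) (cdf \<mu>) s" for n s
    proof -
      have unfold: "?p (Suc m) s = y s + stieltjes_conv (?pp m) (cdf \<mu>) s" for m
        by (rule fun_cong[OF picard.simps(2)])
      show ?thesis
        unfolding unfold F.stieltjes_conv_diff[OF pp pp] by (rule add_diff_cancel_left)
    qed
  qed
  with B(1) show ?thesis
    by (intro that[of "B * exp T"]) auto
qed

text \<open>
  The steps of the iteration decay geometrically, uniformly on \<open>[0, T]\<close>. The limit is written with \<open>lim\<close>,
  without any choice, so that it stays measurable when \<open>y\<close> depends on a sample point.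
\<close>
lemma picard_limit:
  assumes y: "cadlag y"
  defines "q \<equiv> \<lambda>t. lim (\<lambda>n. picard (cdf \<mu>) y n t)"
  shows "\<And>t. 0 \<le> t \<Longrightarrow> (\<lambda>n. picard (cdf \<mu>) y n t) \<longlonglongrightarrow> q t"
    and "cadlag q"
    and "\<And>t. 0 \<le> t \<Longrightarrow> q t = y t + stieltjes_conv (\<lambda>s. max (q s) 0) (cdf \<mu>) t"
proof -
  let ?p = "picard (cdf \<mu>) y"
  have unif: "uniform_limit {0..T} ?p q sequentially" for T
  proof -
    obtain B where B: "0 \<le> B" "\<And>n t. t \<in> {0..T} \<Longrightarrow> \<bar>?p (Suc n) t - ?p n t\<bar> \<le> laplace ^ n * B"
      using picard_step_bound[OF y] by metis
    let ?s = "\<lambda>t. \<Sum>n. ?p (Suc n) t - ?p n t"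
    have "uniform_limit {0..T} (\<lambda>n t. \<Sum>i<n. ?p (Suc i) t - ?p i t) ?s sequentially"
    proof (rule Weierstrass_m_test)
      show "norm (?p (Suc n) t - ?p n t) \<le> laplace ^ n * B" if "t \<in> {0..T}" for n t
        using B(2)[OF that] by simp
      show "summable (\<lambda>n. laplace ^ n * B)"
        using laplace_nonneg laplace_less_1 by (intro summable_mult2 summable_geometric) simp
    qed
    moreover have "(\<Sum>i<n. ?p (Suc i) t - ?p i t) = ?p n t - ?p 0 t" for n t
      using sum_lessThan_telescope[of "\<lambda>i. ?p i t" n] .
    ultimately have "uniform_limit {0..T} (\<lambda>n t. ?p 0 t + (?p n t - ?p 0 t)) (\<lambda>t. ?p 0 t + ?s t) sequentially"
      by (intro uniform_limit_add uniform_limit_const) (simp only:)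
    then have lim: "uniform_limit {0..T} ?p (\<lambda>t. ?p 0 t + ?s t) sequentially"
      by simp
    have "q t = ?p 0 t + ?s t" if "t \<in> {0..T}" for t
      unfolding q_def by (rule limI[OF tendsto_uniform_limitI[OF lim that]])
    then show ?thesis
      using lim by (subst uniform_limit_cong'[where i="\<lambda>t. ?p 0 t + ?s t"]) auto
  qed
  show lim: "(\<lambda>n. ?p n t) \<longlonglongrightarrow> q t" if "0 \<le> t" for t
    by (rule tendsto_uniform_limitI[OF unif[of t]]) (use that in auto)
  show q: "cadlag q"
    by (rule cadlag_uniform_limit[OF cadlag_picard[OF y] unif])
  show "q t = y t + stieltjes_conv (\<lambda>s. max (q s) 0) (cdf \<mu>) t" if t: "0 \<le> t" for t
  proof -
    let ?pp = "\<lambda>n s. max (?p n s) 0" and ?qp = "\<lambda>s. max (q s) 0"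
    have pp: "locally_bounded_borel (?pp n)" and qp: "locally_bounded_borel ?qp" for n
      by (intro locally_bounded_borel_max cadlag_locally_bounded_borel cadlag_picard y q)+
    have "(\<lambda>n. stieltjes_conv (?pp n) (cdf \<mu>) t) \<longlonglongrightarrow> stieltjes_conv ?qp (cdf \<mu>) t"
    proof (rule LIMSEQ_I)
      fix e :: real assume "0 < e"
      \<comment> \<open>By the weighted estimate, a uniform error \<open>d\<close> contributes at most
        \<open>laplace * d * exp t\<close>, which is less than \<open>e\<close>.\<close>
      define d where "d = e / (2 * exp t)"
      have d: "0 < d"
        using \<open>0 < e\<close> by (simp add: d_def)
      have "eventually (\<lambda>n. \<forall>s\<in>{0..t}. dist (?p n s) (q s) < d) sequentially"
        using unif[of t] d by (rule uniform_limitD)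
      then obtain n0 where n0: "\<And>n s. n0 \<le> n \<Longrightarrow> s \<in> {0..t} \<Longrightarrow> dist (?p n s) (q s) < d"
        unfolding eventually_sequentially by blast
      have "norm (stieltjes_conv (?pp n) (cdf \<mu>) t - stieltjes_conv ?qp (cdf \<mu>) t) < e" if n: "n0 \<le> n" for n
      proof -
        have "\<bar>?pp n s - ?qp s\<bar> \<le> d * exp s" if "s \<in> {0..t}" for s
        proof -
          have "\<bar>?pp n s - ?qp s\<bar> \<le> \<bar>?p n s - q s\<bar>"
            by auto
          also have "\<dots> \<le> d * 1"
            using n0[OF n that] by (simp add: dist_real_def)
          also have "\<dots> \<le> d * exp s"
            using d that by (intro mult_left_mono) auto
          finally show ?thesis .
        qed
        then have "\<bar>stieltjes_conv (\<lambda>s. ?pp n s - ?qp s) (cdf \<mu>) t\<bar> \<le> laplace * d * exp t"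
          unfolding laplace_def using d
          by (intro F.stieltjes_conv_exp_bound locally_bounded_borel_diff pp qp) auto
        also have "\<dots> \<le> 1 * d * exp t"
          using laplace_less_1 d by (intro mult_right_mono) auto
        also have "\<dots> < e"
          using \<open>0 < e\<close> by (simp add: d_def)
        finally show ?thesis
          by (simp add: F.stieltjes_conv_diff[OF pp qp])
      qed
      then show "\<exists>n0. \<forall>n\<ge>n0. norm (stieltjes_conv (?pp n) (cdf \<mu>) t - stieltjes_conv ?qp (cdf \<mu>) t) < e"
        by blast
    qed
    then have "(\<lambda>n. ?p (Suc n) t) \<longlonglongrightarrow> y t + stieltjes_conv ?qp (cdf \<mu>) t"
      by (auto intro: tendsto_add)
    moreover have "(\<lambda>n. ?p (Suc n) t) \<longlonglongrightarrow> q t"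
      by (rule LIMSEQ_Suc[OF lim[OF t]])
    ultimately show ?thesis
      by (rule LIMSEQ_unique[rotated])
  qed
qed

text \<open>
  The forcing \<open>Y\<close> has to be cadlag for every sample point, since a strong solution is required to be so;
  the equation itself may fail on a null set.
\<close>
lemma strong_solution_exists:
  assumes meas: "\<And>t. 0 \<le> t \<Longrightarrow> Y t \<in> borel_measurable P"
    and cadlag: "\<And>\<omega>. \<omega> \<in> space P \<Longrightarrow> cadlag (\<lambda>t. Y t \<omega>)"
    and \<Phi>: "AE \<omega> in P. \<forall>q. \<forall>t\<ge>0. \<Phi> \<omega> q t = Y t \<omega> + stieltjes_conv (\<lambda>s. max (q s) 0) (cdf \<mu>) t"
  shows "\<exists>Q. strong_solution P \<Phi> Q"
proof -
  define p where "p n t \<omega> = picard (cdf \<mu>) (\<lambda>t. Y t \<omega>) n t" for n t \<omega>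
  have p_meas: "p n t \<in> borel_measurable P" if "0 \<le> t" for n t
    using that
  proof (induction n arbitrary: t)
    case 0
    then show ?case
      using meas by (simp add: p_def[abs_def])
  next
    case (Suc n)
    have "(\<lambda>\<omega>. stieltjes_conv (\<lambda>s. max (p n s \<omega>) 0) (cdf \<mu>) t) \<in> borel_measurable P"
    proof (rule F.borel_measurable_stieltjes_conv_process)
      show "(\<lambda>\<omega>. max (p n s \<omega>) 0) \<in> borel_measurable P" if "0 \<le> s" for s
        using Suc.IH[OF that] by measurable
      show "cadlag (\<lambda>s. max (p n s \<omega>) 0)" if "\<omega> \<in> space P" for \<omega>
        unfolding p_def by (intro cadlag_max cadlag_picard cadlag that)
    qed
    then have "(\<lambda>\<omega>. Y t \<omega> + stieltjes_conv (\<lambda>s. max (p n s \<omega>) 0) (cdf \<mu>) t) \<in> borel_measurable P"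
      using meas[OF Suc.prems] by (intro borel_measurable_add)
    then show ?case
      by (simp add: p_def[abs_def])
  qed
  define Q where "Q t \<omega> = lim (\<lambda>n. p n t \<omega>)" for t \<omega>
  note limit = picard_limit[OF cadlag, folded p_def Q_def]
  have "strong_solution P \<Phi> Q"
    unfolding strong_solution_def
  proof (intro conjI allI impI ballI)
    show "Q t \<in> borel_measurable P" if "0 \<le> t" for t
      using borel_measurable_LIMSEQ_real[of P "\<lambda>n. p n t" "Q t"] limit(1) p_meas that by blast
    show "AE \<omega> in P. \<forall>t\<ge>0. Q t \<omega> = \<Phi> \<omega> (\<lambda>s. Q s \<omega>) t"
      using \<Phi> AE_space by eventually_elim (simp add: limit(3))
  qed (rule limit(2))
  then show ?thesis
    by (rule exI[of _ Q])
qed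

lemma strong_solution_unique:
  assumes \<Phi>: "AE \<omega> in P. \<forall>q. \<forall>t\<ge>0. \<Phi> \<omega> q t = Y t \<omega> + stieltjes_conv (\<lambda>s. max (q s) 0) (cdf \<mu>) t"
    and Q: "strong_solution P \<Phi> Q" and R: "strong_solution P \<Phi> R"
  shows "AE \<omega> in P. \<forall>t\<ge>0. Q t \<omega> = R t \<omega>"
proof -
  have "AE \<omega> in P. \<forall>t\<ge>0. Q t \<omega> = \<Phi> \<omega> (\<lambda>s. Q s \<omega>) t" "AE \<omega> in P. \<forall>t\<ge>0. R t \<omega> = \<Phi> \<omega> (\<lambda>s. R s \<omega>) t"
    using Q R by (simp_all add: strong_solution_def)
  with \<Phi> AE_space show ?thesis
  proof eventually_elim
    case (elim \<omega>)
    define q r where "q t = Q t \<omega>" and "r t = R t \<omega>" for t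
    have q: "locally_bounded_borel q" and r: "locally_bounded_borel r"
      using Q R elim(2) unfolding strong_solution_def q_def r_def
      by (auto intro: cadlag_locally_bounded_borel)
    note mx = locally_bounded_borel_max[OF q] locally_bounded_borel_max[OF r]
    have eq: "q t - r t = stieltjes_conv (\<lambda>s. max (q s) 0 - max (r s) 0) (cdf \<mu>) t" if "0 \<le> t" for t
    proof -
      have "q t = Y t \<omega> + stieltjes_conv (\<lambda>s. max (q s) 0) (cdf \<mu>) t"
        "r t = Y t \<omega> + stieltjes_conv (\<lambda>s. max (r s) 0) (cdf \<mu>) t"
        using elim that unfolding q_def r_def by auto
      then show ?thesis
        by (simp add: F.stieltjes_conv_diff[OF mx])
    qed
    have "q t - r t = 0" if "0 \<le> t" for t
      by (rule stieltjes_conv_contraction_zero[OF locally_bounded_borel_diff[OF q r]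
            locally_bounded_borel_diff[OF mx] _ eq that]) auto
    then show ?case
      by (simp add: q_def r_def)
  qed
qed

text \<open>
  The pathwise equivalence applies to almost every sample point, so the two notions of strong solution
  agree, and with them uniqueness.
\<close>
lemma strong_solution_renewal_equivalence:
  assumes \<zeta>: "AE \<omega> in P. cadlag (\<lambda>t. \<zeta> t \<omega>)" and w: "locally_bounded_borel w"
    and \<Phi>F: "AE \<omega> in P. \<forall>q. \<forall>t\<ge>0. \<Phi>F \<omega> q t
      = \<zeta> t \<omega> - (w t - stieltjes_conv w (cdf \<mu>) t) + stieltjes_conv (\<lambda>s. max (q s) 0) (cdf \<mu>) t"
    and \<Phi>M: "AE \<omega> in P. \<forall>q. \<forall>t\<ge>0. \<Phi>M \<omega> q t
      = \<zeta> t \<omega> + stieltjes_conv (\<lambda>s. \<zeta> s \<omega>) (cdf (renewal_measure \<mu>)) t - w t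
        - stieltjes_conv (\<lambda>s. min (q s) 0) (cdf (renewal_measure \<mu>)) t"
  shows "strong_solution P \<Phi>F Q \<longleftrightarrow> strong_solution P \<Phi>M Q"
proof -
  have "(AE \<omega> in P. \<forall>t\<ge>0. Q t \<omega> = \<Phi>F \<omega> (\<lambda>s. Q s \<omega>) t)
      \<longleftrightarrow> (AE \<omega> in P. \<forall>t\<ge>0. Q t \<omega> = \<Phi>M \<omega> (\<lambda>s. Q s \<omega>) t)"
    if cadlag: "\<forall>\<omega>\<in>space P. cadlag (\<lambda>t. Q t \<omega>)"
  proof (rule eventually_subst)
    show "AE \<omega> in P. (\<forall>t\<ge>0. Q t \<omega> = \<Phi>F \<omega> (\<lambda>s. Q s \<omega>) t) = (\<forall>t\<ge>0. Q t \<omega> = \<Phi>M \<omega> (\<lambda>s. Q s \<omega>) t)"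
      using \<zeta> \<Phi>F \<Phi>M AE_space
    proof eventually_elim
      case (elim \<omega>)
      then have "locally_bounded_borel (\<lambda>t. Q t \<omega>)" "locally_bounded_borel (\<lambda>t. \<zeta> t \<omega>)"
        using cadlag by (auto intro: cadlag_locally_bounded_borel)
      from renewal_resolvent_equivalence[OF this w] elim(2,3) show ?case
        by simp
    qed
  qed
  then show ?thesis
    unfolding strong_solution_def by blast
qed

end

section \<open>The two equations for the diffusion limit\<close>
theorem corollary5p2:
  fixes P :: "'w measure" and \<mu> :: "real measure"
    and F G Fe M :: "real \<Rightarrow> real" and \<beta> :: real
    and Q0 :: "'w \<Rightarrow> real"
    and W0 \<xi> M2 H MQ M1 QI \<zeta> :: "real \<Rightarrow> 'w \<Rightarrow> real"
    and \<Phi>F \<Phi>M :: "'w \<Rightarrow> (real \<Rightarrow> real) \<Rightarrow> real \<Rightarrow> real"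
  assumes "prob_space P"
    and "real_distribution \<mu>" and "AE x in \<mu>. 0 \<le> x" and "has_bochner_integral \<mu> (\<lambda>x. x) 1"
    and F: "F = cdf \<mu>"
    and G: "G = (\<lambda>x. 1 - F x)"
    and Fe: "Fe = (\<lambda>x. LBINT u:{0..x}. G u)"
    and M: "M = renewal_function F"
    and "Q0 \<in> borel_measurable P"
    and "brownian_bridge P W0"
    and "\<forall>t\<ge>0. \<xi> t \<in> borel_measurable P"
    and "AE \<omega> in P. continuous_on {0..} (\<lambda>t. \<xi> t \<omega>)"
    and "centered_gaussian_process P {0..} M2"
    and "\<forall>\<omega>\<in>space P. cadlag (\<lambda>t. M2 t \<omega>)"
    and "\<forall>t\<ge>0. \<forall>\<delta>\<ge>0.
           (LINT \<omega>|P. M2 t \<omega> * M2 (t + \<delta>) \<omega>) = (LBINT u:{0..t}. G (t + \<delta> - u) * F (t - u))"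
    and "independent_processes P {0..} [\<lambda>t \<omega>. Q0 \<omega>, \<lambda>t. W0 (Fe t), \<xi>, M2]"
    and H: "H = (\<lambda>t \<omega>. Q0 \<omega> * (1 - Fe t))"
    and MQ: "MQ = (\<lambda>t \<omega>. max (Q0 \<omega>) 0 * (G t - (1 - Fe t)))"
    and M1: "M1 = (\<lambda>t \<omega>. \<xi> t \<omega> - stieltjes_conv (\<lambda>s. \<xi> s \<omega>) F t)"
    and QI: "QI = (\<lambda>t \<omega>. H t \<omega> + W0 (Fe t) \<omega> + M1 t \<omega> + M2 t \<omega>)"
    and \<zeta>: "\<zeta> = (\<lambda>t \<omega>. MQ t \<omega> + QI t \<omega>)"
    and \<Phi>F: "\<Phi>F = (\<lambda>\<omega> q t. MQ t \<omega> + QI t \<omega> - \<beta> * Fe t + stieltjes_conv (\<lambda>s. max (q s) 0) F t)"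
    and \<Phi>M: "\<Phi>M = (\<lambda>\<omega> q t. \<zeta> t \<omega> + stieltjes_conv (\<lambda>s. \<zeta> s \<omega>) M t - \<beta> * t
                          - stieltjes_conv (\<lambda>s. min (q s) 0) M t)"
  shows "(\<exists>QF. unique_strong_solution P \<Phi>F QF) \<and>
         (\<forall>QF. unique_strong_solution P \<Phi>F QF \<longrightarrow> unique_strong_solution P \<Phi>M QF)"
proof -
  interpret \<mu>: real_distribution \<mu> by fact
  have mean: "has_bochner_integral \<mu> (\<lambda>x. x) 1" by fact
  interpret R: interarrival_law \<mu>
  proof
    show "\<not> (AE x in \<mu>. x = 0)"
    proof
      assume "AE x in \<mu>. x = 0"
      then have "(\<integral>x. x \<partial>\<mu>) = 0"
        by (rule integral_eq_zero_AE)
      then show False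
        using mean by (simp add: has_bochner_integral_iff)
    qed
  qed fact
  have M_eq: "M = cdf (renewal_measure \<mu>)"
    by (simp add: M F R.renewal_function_cdf)
  have Fe_eq: "Fe t = t - stieltjes_conv (\<lambda>s. s) (cdf \<mu>) t" if "0 \<le> t" for t
    using R.integrated_tail[OF that] by (simp add: Fe G F)
  have Fe_mem: "Fe t \<in> {0..1}" if "0 \<le> t" for t
    using R.integrated_tail_bounds[OF that mean] by (simp add: Fe_eq[OF that])
  have cadlag_id: "cadlag (\<lambda>t. t)"
    by (intro cadlag_continuous continuous_on_id)
  have cadlag_Fe: "cadlag Fe"
    by (rule cadlag_cong[OF cadlag_diff[OF cadlag_id R.F.cadlag_stieltjes_conv[OF cadlag_id]]])
      (simp add: Fe_eq)
  have cadlag_G: "cadlag G"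
    by (rule cadlag_cong[OF cadlag_diff[OF cadlag_const[of 1] R.F.cadlag_stieltjes_conv[OF cadlag_const[of 1]]]])
      (simp add: G F R.F.stieltjes_conv_one)

  have AE_paths: "AE \<omega> in P. continuous_on {0..1} (\<lambda>t. W0 t \<omega>) \<and> continuous_on {0..} (\<lambda>t. \<xi> t \<omega>)"
    using assms(10,12) unfolding brownian_bridge_def by auto
  obtain N0 where N0: "N0 \<in> sets P" "emeasure P N0 = 0"
    "{\<omega>\<in>space P. \<not> (continuous_on {0..1} (\<lambda>t. W0 t \<omega>) \<and> continuous_on {0..} (\<lambda>t. \<xi> t \<omega>))} \<subseteq> N0"
  proof (rule AE_E[OF AE_paths])
    fix N assume "{\<omega>\<in>space P. \<not> (continuous_on {0..1} (\<lambda>t. W0 t \<omega>) \<and> continuous_on {0..} (\<lambda>t. \<xi> t \<omega>))} \<subseteq> N"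
      "emeasure P N = 0" "N \<in> sets P"
    then show thesis
      by (intro that)
  qed
  then have AE_N0: "AE \<omega> in P. \<omega> \<notin> N0"
    by (intro AE_not_in) auto

  \<comment> \<open>The bridge and \<open>\<xi>\<close> have continuous paths only off the null set \<open>N0\<close>. On it \<open>\<xi>\<close>, and below the
    whole forcing term, is replaced by \<open>0\<close>, so that every path is cadlag and convolutions are
    measurable in the sample point.\<close>
  define \<xi>' where "\<xi>' t \<omega> = (if \<omega> \<in> N0 then 0 else \<xi> t \<omega>)" for t \<omega>
  have cadlag_\<xi>': "cadlag (\<lambda>t. \<xi>' t \<omega>)" if "\<omega> \<in> space P" for \<omega>
    using that N0(3) by (cases "\<omega> \<in> N0") (auto simp: \<xi>'_def intro: cadlag_const cadlag_continuous)
  note [measurable] = N0(1) \<open>Q0 \<in> borel_measurable P\<close>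
  have \<xi>'_meas: "\<xi>' t \<in> borel_measurable P" if "0 \<le> t" for t
  proof -
    have [measurable]: "\<xi> t \<in> borel_measurable P"
      using assms(11) that by simp
    show ?thesis
      unfolding \<xi>'_def[abs_def] by measurable
  qed
  have conv_\<xi>'_meas: "(\<lambda>\<omega>. stieltjes_conv (\<lambda>s. \<xi>' s \<omega>) F t) \<in> borel_measurable P" for t
    unfolding F
    by (rule R.F.borel_measurable_stieltjes_conv_process[OF \<xi>'_meas cadlag_\<xi>'])
  have gaussian_meas: "X t \<in> borel_measurable P"
    if "centered_gaussian_process P T X" "t \<in> T" for X :: "real \<Rightarrow> 'w \<Rightarrow> real" and T t
  proof -
    have "gaussian_rv P (\<lambda>\<omega>. \<Sum>s\<in>{t}. 1 * X s \<omega>)"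
      using that(1)[unfolded centered_gaussian_process_def, THEN conjunct1, rule_format,
          of "{t}" "\<lambda>_. 1"] that(2) by simp
    then show ?thesis
      by (simp add: gaussian_rv_def)
  qed
  have W0_meas: "W0 (Fe t) \<in> borel_measurable P" if "0 \<le> t" for t
    using assms(10) Fe_mem[OF that] unfolding brownian_bridge_def by (blast intro: gaussian_meas)
  have M2_meas: "M2 t \<in> borel_measurable P" if "0 \<le> t" for t
    using gaussian_meas[OF assms(13)] that by simp

  have cadlag_\<zeta>: "cadlag (\<lambda>t. \<zeta> t \<omega>)" if \<omega>: "\<omega> \<in> space P" "\<omega> \<notin> N0" for \<omega>
  proof -
    have W: "continuous_on {0..1} (\<lambda>t. W0 t \<omega>)" and \<xi>: "cadlag (\<lambda>t. \<xi> t \<omega>)"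
      using N0(3) \<omega> by (auto intro: cadlag_continuous)
    have "cadlag (\<lambda>t. M2 t \<omega>)"
      using assms(14) \<omega> by simp
    then show ?thesis
      unfolding \<zeta> MQ QI H M1 F
      by (intro cadlag_add cadlag_diff cadlag_mult cadlag_const cadlag_G cadlag_Fe \<xi>
          R.F.cadlag_stieltjes_conv cadlag_compose_continuous[OF W _ cadlag_Fe] Fe_mem) auto
  qed
  then have AE_cadlag_\<zeta>: "AE \<omega> in P. cadlag (\<lambda>t. \<zeta> t \<omega>)"
    using AE_N0 AE_space by (auto elim: eventually_elim2)

  define Y where "Y t \<omega> = (if \<omega> \<in> N0 then 0 else \<zeta> t \<omega> - \<beta> * Fe t)" for t \<omega>
  have cadlag_Y: "cadlag (\<lambda>t. Y t \<omega>)" if "\<omega> \<in> space P" for \<omega>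
    using that unfolding Y_def
    by (cases "\<omega> \<in> N0") (simp_all add: cadlag_const cadlag_diff cadlag_mult cadlag_\<zeta> cadlag_Fe)
  have Y_meas: "Y t \<in> borel_measurable P" if t: "0 \<le> t" for t
  proof -
    note [measurable] = \<xi>'_meas[OF t] conv_\<xi>'_meas[of t] W0_meas[OF t] M2_meas[OF t]
    have "Y t = (\<lambda>\<omega>. if \<omega> \<in> N0 then 0 else MQ t \<omega> + (H t \<omega> + W0 (Fe t) \<omega>
        + (\<xi>' t \<omega> - stieltjes_conv (\<lambda>s. \<xi>' s \<omega>) F t) + M2 t \<omega>) - \<beta> * Fe t)"
      by (auto simp: Y_def \<zeta> QI M1 \<xi>'_def fun_eq_iff)
    also have "\<dots> \<in> borel_measurable P"
      unfolding MQ H by measurable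
    finally show ?thesis .
  qed
  have \<Phi>F_Y: "AE \<omega> in P. \<forall>q. \<forall>t\<ge>0. \<Phi>F \<omega> q t = Y t \<omega> + stieltjes_conv (\<lambda>s. max (q s) 0) (cdf \<mu>) t"
    using AE_N0 by eventually_elim (simp add: \<Phi>F Y_def \<zeta> F)

  have unique_F: "unique_strong_solution P \<Phi>F Q \<longleftrightarrow> strong_solution P \<Phi>F Q" for Q
    unfolding unique_strong_solution_def using R.strong_solution_unique[OF \<Phi>F_Y] by blast
  have lbb: "locally_bounded_borel (\<lambda>t. \<beta> * t)"
    by (intro locally_bounded_borel_cmult locally_bounded_borel_ident)
  have equiv: "strong_solution P \<Phi>F Q \<longleftrightarrow> strong_solution P \<Phi>M Q" for Q
  proof (rule R.strong_solution_renewal_equivalence[OF AE_cadlag_\<zeta> lbb])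
    have "\<beta> * t - stieltjes_conv (\<lambda>t. \<beta> * t) (cdf \<mu>) t = \<beta> * Fe t" if "0 \<le> t" for t
      by (simp add: R.F.stieltjes_conv_cmult[OF locally_bounded_borel_ident] Fe_eq[OF that]
          right_diff_distrib)
    then show "AE \<omega> in P. \<forall>q. \<forall>t\<ge>0. \<Phi>F \<omega> q t = \<zeta> t \<omega>
        - (\<beta> * t - stieltjes_conv (\<lambda>t. \<beta> * t) (cdf \<mu>) t) + stieltjes_conv (\<lambda>s. max (q s) 0) (cdf \<mu>) t"
      by (simp add: \<Phi>F \<zeta> F)
  qed (simp add: \<Phi>M M_eq)
  have "unique_strong_solution P \<Phi>M Q" if "unique_strong_solution P \<Phi>F Q" for Q
    using that unfolding unique_strong_solution_def equiv .
  moreover have "\<exists>Q. unique_strong_solution P \<Phi>F Q"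
    unfolding unique_F by (rule R.strong_solution_exists[OF Y_meas cadlag_Y \<Phi>F_Y])
  ultimately show ?thesis
    by blast
qed

end
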